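(* Let $M^{2n}$ be a quasitoric manifold over a simple polytope $P$ of dimension $n$, let $K_P$ be the simplicial complex dual to the boundary of $P$, and let $r\ge1$ be an integer. If the tangent bundle $\tau_M$ of $M^{2n}$ is stably equivariantly isomorphic to a direct sum of $r$ $2$-dimensional $T^n$-equivariant real vector bundles over $M^{2n}$, then $K_P$ admits an $r$-coloring.
   Context: $T^n=(S^1)^n$. A quasitoric manifold $M^{2n}$ over an $n$-dimensional simple polytope $P$ is a closed smooth $2n$-dimensional manifold with a smooth $T^n$-action that is locally standard (every point has a $T^n$-invariant open neighbourhood which is, up to an automorphism of $T^n$, equivariantly diffeomorphic to a $T^n$-invariant open subset of $\mathbb{C}^n$ with the standard coordinatewise action) and whose orbit space $M^{2n}/T^n$ is $P$ (as a manifold with corners). The tangent bundle $\tau_M$ is a $T^n$-equivariant real vector bundle via the differential of the action. If $F_1,\dots,F_m$ are the facets of $P$, then $K_P$ is the simplicial complex on $[m]=\{1,\dots,m\}$ whose faces are the empty set and the nonempty subsets $\alpha\subseteq[m]$ with $\bigcap_{i\in\alpha}F_i\ne\emptyset$. An $r$-coloring of a simplicial complex $K$ on the vertex set $[m]$ is a non-degenerate simplicial map $K\to\Delta[r]$ to the full simplex on $[r]=\{1,\dots,r\}$, i.e. a map $[m]\to[r]$ whose restriction to each face of $K$ is injective. Two $T^n$-equivariant real vector bundles $\xi,\eta$ over $M^{2n}$ are stably equivariantly isomorphic if $\xi\oplus\mathbb{R}^a\cong\eta\oplus\mathbb{R}^b$ as $T^n$-equivariant real vector bundles for some $a,b\ge0$,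 where $\mathbb{R}^k$ denotes the trivial bundle $\mathbb{R}^k\times M^{2n}$ with $T^n$ acting trivially on the factor $\mathbb{R}^k$. *)

theory Defs
  imports "HOL-Analysis.Analysis"
begin

section \<open>Smooth manifolds\<close>

text \<open>Maps of class \<open>C\<^sup>k\<close> on a set, which is open in all uses below.\<close>

primrec Ck_on :: "nat \<Rightarrow> 'a::euclidean_space set \<Rightarrow> ('a \<Rightarrow> 'b::real_normed_vector) \<Rightarrow> bool" where
  "Ck_on 0 S f \<longleftrightarrow> continuous_on S f"
| "Ck_on (Suc k) S f \<longleftrightarrow> (\<forall>x\<in>S. f differentiable (at x)) \<and>
     (\<forall>v. Ck_on k S (\<lambda>x. frechet_derivative f (at x) v))"

definition smooth_on :: "'a::euclidean_space set \<Rightarrow> ('a \<Rightarrow> 'b::real_normed_vector) \<Rightarrow> bool" where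
  "smooth_on S f \<longleftrightarrow> (\<forall>k. Ck_on k S f)"

text \<open>A chart is a domain together with a coordinate map; the values of the coordinate map
  outside the domain are irrelevant.\<close>

type_synonym ('m, 'e) chart = "'m set \<times> ('m \<Rightarrow> 'e)"

definition is_chart :: "'m topology \<Rightarrow> ('m, 'e::euclidean_space) chart \<Rightarrow> bool" where
  "is_chart X c \<longleftrightarrow> openin X (fst c) \<and> open (snd c ` fst c) \<and>
     homeomorphic_map (subtopology X (fst c)) (top_of_set (snd c ` fst c)) (snd c)"

definition transition :: "('m, 'e) chart \<Rightarrow> ('m, 'e) chart \<Rightarrow> 'e \<Rightarrow> 'e" where
  "transition c d = snd d \<circ> inv_into (fst c) (snd c)"

definition compatible :: "('m, 'e::euclidean_space) chart \<Rightarrow> ('m, 'e) chart \<Rightarrow> bool" where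
  "compatible c d \<longleftrightarrow>
     smooth_on (snd c ` (fst c \<inter> fst d)) (transition c d) \<and>
     smooth_on (snd d ` (fst c \<inter> fst d)) (transition d c)"

definition smooth_manifold :: "'m topology \<Rightarrow> ('m, 'e::euclidean_space) chart set \<Rightarrow> bool" where
  "smooth_manifold X A \<longleftrightarrow> Hausdorff_space X \<and> second_countable X \<and>
     (\<forall>c\<in>A. is_chart X c) \<and> (\<Union>c\<in>A. fst c) = topspace X \<and>
     (\<forall>c\<in>A. \<forall>d\<in>A. compatible c d)"

definition closed_smooth_manifold :: "'m topology \<Rightarrow> ('m, 'e::euclidean_space) chart set \<Rightarrow> bool" where
  "closed_smooth_manifold X A \<longleftrightarrow> smooth_manifold X A \<and> compact_space X"

text \<open>The charts of the maximal atlas: the diffeomorphisms from open subsets of the manifold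
  onto open subsets of the model space.\<close>

definition smooth_chart :: "'m topology \<Rightarrow> ('m, 'e::euclidean_space) chart set \<Rightarrow> ('m, 'e) chart \<Rightarrow> bool" where
  "smooth_chart X A c \<longleftrightarrow> is_chart X c \<and> (\<forall>d\<in>A. compatible c d)"

section \<open>Torus actions\<close>

text \<open>The group law of \<open>(S\<^sup>1)\<^sup>n\<close> is the componentwise multiplication of \<^typ>\<open>complex^'n\<close>, which is
  also the standard coordinatewise action on \<^typ>\<open>complex^'n\<close>.\<close>

definition torus :: "(complex^'n) set" where
  "torus = {t. \<forall>i. cmod (t $ i) = 1}"

definition torus_exp :: "real^'n \<Rightarrow> complex^'n" where
  "torus_exp \<theta> = (\<chi> i. cis (\<theta> $ i))"

definition torus_automorphism :: "(complex^'n \<Rightarrow> complex^'n) \<Rightarrow> bool" where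
  "torus_automorphism \<psi> \<longleftrightarrow> bij_betw \<psi> torus torus \<and> continuous_on torus \<psi> \<and>
     (\<forall>s\<in>torus. \<forall>t\<in>torus. \<psi> (s * t) = \<psi> s * \<psi> t)"

definition continuous_torus_action :: "'m topology \<Rightarrow> (complex^'n \<Rightarrow> 'm \<Rightarrow> 'm) \<Rightarrow> bool" where
  "continuous_torus_action X \<rho> \<longleftrightarrow>
     continuous_map (prod_topology (top_of_set torus) X) X (\<lambda>(t, x). \<rho> t x) \<and>
     (\<forall>x\<in>topspace X. \<rho> 1 x = x) \<and>
     (\<forall>s\<in>torus. \<forall>t\<in>torus. \<forall>x\<in>topspace X. \<rho> (s * t) x = \<rho> s (\<rho> t x))"

text \<open>Smoothness of the action map \<open>T \<times> M \<rightarrow> M\<close> is tested after composition with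
  the local diffeomorphism \<^const>\<open>torus_exp\<close> onto \<open>T\<close>.\<close>

definition smooth_torus_action ::
    "'m topology \<Rightarrow> ('m, 'e::euclidean_space) chart set \<Rightarrow> (complex^'n \<Rightarrow> 'm \<Rightarrow> 'm) \<Rightarrow> bool" where
  "smooth_torus_action X A \<rho> \<longleftrightarrow> continuous_torus_action X \<rho> \<and>
     (\<forall>c\<in>A. \<forall>d\<in>A.
        smooth_on
          {(\<theta>, u). u \<in> snd c ` fst c \<and> \<rho> (torus_exp \<theta>) (inv_into (fst c) (snd c) u) \<in> fst d}
          (\<lambda>(\<theta>, u). snd d (\<rho> (torus_exp \<theta>) (inv_into (fst c) (snd c) u))))"

section \<open>Quasitoric manifolds\<close>

definition simple_polytope :: "nat \<Rightarrow> 'p::euclidean_space set \<Rightarrow> bool" where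
  "simple_polytope n P \<longleftrightarrow> polytope P \<and> aff_dim P = int n \<and>
     (\<forall>v. v extreme_point_of P \<longrightarrow> card {F. F facet_of P \<and> v \<in> F} = n)"

definition standard_chart ::
    "'m topology \<Rightarrow> ('m, complex^'n) chart set \<Rightarrow> (complex^'n \<Rightarrow> 'm \<Rightarrow> 'm) \<Rightarrow>
     ('m, complex^'n) chart \<Rightarrow> (complex^'n \<Rightarrow> complex^'n) \<Rightarrow> bool" where
  "standard_chart X A \<rho> c \<psi> \<longleftrightarrow> smooth_chart X A c \<and> torus_automorphism \<psi> \<and>
     (\<forall>t\<in>torus. \<forall>x\<in>fst c. \<rho> t x \<in> fst c \<and> snd c (\<rho> t x) = \<psi> t * snd c x)"

definition locally_standard ::
    "'m topology \<Rightarrow> ('m, complex^'n) chart set \<Rightarrow> (complex^'n \<Rightarrow> 'm \<Rightarrow> 'm) \<Rightarrow> bool" where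
  "locally_standard X A \<rho> \<longleftrightarrow>
     (\<forall>x\<in>topspace X. \<exists>c \<psi>. x \<in> fst c \<and> standard_chart X A \<rho> c \<psi>)"

text \<open>The map \<open>\<pi>\<close> induces an isomorphism of (topological) manifolds with corners from the orbit
  space onto the simple polytope \<open>P\<close>: a homeomorphism preserving the codimension of corners.  A
  standard chart \<open>\<phi>\<close> around \<open>x\<close> gives the corner chart \<open>[y] \<mapsto> (\<bar>\<phi>\<^sub>1 y\<bar>, \<dots>, \<bar>\<phi>\<^sub>n y\<bar>)\<close> of the orbit space, so
  the codimension at \<open>[x]\<close> is the number of vanishing coordinates of \<open>\<phi> x\<close>; in a simple polytope
  the codimension of the smallest face containing a point is the number of facets containing it.\<close>

definition orbit_projection ::
    "'m topology \<Rightarrow> ('m, complex^'n) chart set \<Rightarrow> (complex^'n \<Rightarrow> 'm \<Rightarrow> 'm) \<Rightarrow>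
     'p::euclidean_space set \<Rightarrow> ('m \<Rightarrow> 'p) \<Rightarrow> bool" where
  "orbit_projection X A \<rho> P \<pi> \<longleftrightarrow> quotient_map X (top_of_set P) \<pi> \<and>
     (\<forall>x\<in>topspace X. \<forall>y\<in>topspace X. \<pi> x = \<pi> y \<longleftrightarrow> (\<exists>t\<in>torus. y = \<rho> t x)) \<and>
     (\<forall>c \<psi>. standard_chart X A \<rho> c \<psi> \<longrightarrow>
        (\<forall>x\<in>fst c. card {i. snd c x $ i = 0} = card {F. F facet_of P \<and> \<pi> x \<in> F}))"

definition quasitoric_manifold ::
    "'m topology \<Rightarrow> ('m, complex^'n) chart set \<Rightarrow> (complex^'n \<Rightarrow> 'm \<Rightarrow> 'm) \<Rightarrow>
     'p::euclidean_space set \<Rightarrow> bool" where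
  "quasitoric_manifold X A \<rho> P \<longleftrightarrow> simple_polytope CARD('n) P \<and>
     closed_smooth_manifold X A \<and> smooth_torus_action X A \<rho> \<and> locally_standard X A \<rho> \<and>
     (\<exists>\<pi>. orbit_projection X A \<rho> P \<pi>)"

section \<open>Equivariant vector bundles\<close>

record ('b, 'g, 'e) equivariant_bundle =
  total :: "'e topology"
  proj :: "'e \<Rightarrow> 'b"
  vadd :: "'e \<Rightarrow> 'e \<Rightarrow> 'e"
  vscale :: "real \<Rightarrow> 'e \<Rightarrow> 'e"
  gact :: "'g \<Rightarrow> 'e \<Rightarrow> 'e"

text \<open>The vector space axioms for the fibres follow from the existence of
  local trivialisations by fibrewise linear bijections.\<close>

definition local_trivialisation ::
    "'b topology \<Rightarrow> nat \<Rightarrow> ('b, 'g, 'e) equivariant_bundle \<Rightarrow> 'b set \<Rightarrow>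
     ('b \<times> (nat \<Rightarrow> real) \<Rightarrow> 'e) \<Rightarrow> bool" where
  "local_trivialisation X k B U h \<longleftrightarrow>
     homeomorphic_map (prod_topology (subtopology X U) (Euclidean_space k))
       (subtopology (total B) {e. proj B e \<in> U}) h \<and>
     (\<forall>x\<in>U. \<forall>a\<in>topspace (Euclidean_space k).
        proj B (h (x, a)) = x \<and>
        (\<forall>b\<in>topspace (Euclidean_space k). h (x, \<lambda>i. a i + b i) = vadd B (h (x, a)) (h (x, b))) \<and>
        (\<forall>s. h (x, \<lambda>i. s * a i) = vscale B s (h (x, a))))"

definition equivariant_vector_bundle ::
    "'b topology \<Rightarrow> (complex^'n \<Rightarrow> 'b \<Rightarrow> 'b) \<Rightarrow> nat \<Rightarrow>
     ('b, complex^'n, 'e) equivariant_bundle \<Rightarrow> bool" where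
  "equivariant_vector_bundle X \<rho> k B \<longleftrightarrow>
     continuous_map (total B) X (proj B) \<and>
     (\<forall>x\<in>topspace X. \<exists>U h. openin X U \<and> x \<in> U \<and> local_trivialisation X k B U h) \<and>
     continuous_torus_action (total B) (gact B) \<and>
     (\<forall>t\<in>torus. \<forall>u\<in>topspace (total B).
        proj B (gact B t u) = \<rho> t (proj B u) \<and>
        (\<forall>v\<in>topspace (total B). proj B u = proj B v \<longrightarrow>
           gact B t (vadd B u v) = vadd B (gact B t u) (gact B t v)) \<and>
        (\<forall>s. gact B t (vscale B s u) = vscale B s (gact B t u)))"

definition equivariant_bundle_iso ::
    "('b, complex^'n, 'e) equivariant_bundle \<Rightarrow> ('b, complex^'n, 'f) equivariant_bundle \<Rightarrow>
     ('e \<Rightarrow> 'f) \<Rightarrow> bool" where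
  "equivariant_bundle_iso B C f \<longleftrightarrow> homeomorphic_map (total B) (total C) f \<and>
     (\<forall>u\<in>topspace (total B).
        proj C (f u) = proj B u \<and>
        (\<forall>v\<in>topspace (total B). proj B u = proj B v \<longrightarrow> f (vadd B u v) = vadd C (f u) (f v)) \<and>
        (\<forall>s. f (vscale B s u) = vscale C s (f u)) \<and>
        (\<forall>t\<in>torus. f (gact B t u) = gact C t (f u)))"

definition trivial_bundle ::
    "'b topology \<Rightarrow> ('g \<Rightarrow> 'b \<Rightarrow> 'b) \<Rightarrow> nat \<Rightarrow> ('b, 'g, (nat \<Rightarrow> real) \<times> 'b) equivariant_bundle" where
  "trivial_bundle X \<rho> k =
    \<lparr>total = prod_topology (Euclidean_space k) X,
     proj = snd,
     vadd = (\<lambda>(a, x) (b, y). (\<lambda>i. a i + b i, x)),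
     vscale = (\<lambda>s (a, x). (\<lambda>i. s * a i, x)),
     gact = (\<lambda>t (a, x). (a, \<rho> t x))\<rparr>"

definition whitney_sum ::
    "('b, 'g, 'e) equivariant_bundle \<Rightarrow> ('b, 'g, 'f) equivariant_bundle \<Rightarrow>
     ('b, 'g, 'e \<times> 'f) equivariant_bundle" where
  "whitney_sum B C =
    \<lparr>total = subtopology (prod_topology (total B) (total C)) {(u, v). proj B u = proj C v},
     proj = (\<lambda>(u, v). proj B u),
     vadd = (\<lambda>(u, v) (u', v'). (vadd B u u', vadd C v v')),
     vscale = (\<lambda>s (u, v). (vscale B s u, vscale C s v)),
     gact = (\<lambda>t (u, v). (gact B t u, gact C t v))\<rparr>"

text \<open>The sum of \<open>\<xi> 1, \<dots>, \<xi> r\<close> for \<open>r \<ge> 1\<close>.\<close>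

definition whitney_sum_family ::
    "nat \<Rightarrow> (nat \<Rightarrow> ('b, 'g, 'e) equivariant_bundle) \<Rightarrow>
     ('b, 'g, nat \<Rightarrow> 'e) equivariant_bundle" where
  "whitney_sum_family r \<xi> =
    \<lparr>total = subtopology (product_topology (\<lambda>j. total (\<xi> j)) {1..r})
       {w. \<forall>j\<in>{1..r}. proj (\<xi> j) (w j) = proj (\<xi> 1) (w 1)},
     proj = (\<lambda>w. proj (\<xi> 1) (w 1)),
     vadd = (\<lambda>w w'. \<lambda>j\<in>{1..r}. vadd (\<xi> j) (w j) (w' j)),
     vscale = (\<lambda>s w. \<lambda>j\<in>{1..r}. vscale (\<xi> j) s (w j)),
     gact = (\<lambda>t w. \<lambda>j\<in>{1..r}. gact (\<xi> j) t (w j))\<rparr>"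

definition stably_equivariantly_isomorphic ::
    "'b topology \<Rightarrow> (complex^'n \<Rightarrow> 'b \<Rightarrow> 'b) \<Rightarrow> ('b, complex^'n, 'e) equivariant_bundle \<Rightarrow>
     ('b, complex^'n, 'f) equivariant_bundle \<Rightarrow> bool" where
  "stably_equivariantly_isomorphic X \<rho> B C \<longleftrightarrow>
     (\<exists>a b f. equivariant_bundle_iso (whitney_sum B (trivial_bundle X \<rho> a))
                (whitney_sum C (trivial_bundle X \<rho> b)) f)"

section \<open>The tangent bundle\<close>

text \<open>A tangent vector at \<open>x\<close> is the family of its coordinate vectors in all charts around \<open>x\<close>,
  related by the derivatives of the transition maps; the entries at other charts are set to \<open>0\<close>.\<close>

definition tangent_vectors :: "'m topology \<Rightarrow> ('m, 'e::euclidean_space) chart set \<Rightarrow>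
    ('m \<times> (('m, 'e) chart \<Rightarrow> 'e)) set" where
  "tangent_vectors X A = {(x, v). x \<in> topspace X \<and>
     (\<forall>c. c \<notin> A \<or> x \<notin> fst c \<longrightarrow> v c = 0) \<and>
     (\<forall>c\<in>A. \<forall>d\<in>A. x \<in> fst c \<inter> fst d \<longrightarrow>
        v d = frechet_derivative (transition c d) (at (snd c x)) (v c))}"

text \<open>The topology for which \<open>(x, v) \<mapsto> (\<phi> x, v\<^sub>\<phi>)\<close> is a chart for every chart \<open>\<phi>\<close> of the atlas.\<close>

definition tangent_topology :: "'m topology \<Rightarrow> ('m, 'e::euclidean_space) chart set \<Rightarrow>
    ('m \<times> (('m, 'e) chart \<Rightarrow> 'e)) topology" where
  "tangent_topology X A = topology_generated_by
     {{(x, v). (x, v) \<in> tangent_vectors X A \<and> x \<in> fst c \<and> (snd c x, v c) \<in> W} | c W.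
        c \<in> A \<and> open W}"

text \<open>The differential of a map \<open>f\<close>.  The result does not depend on the choice of the chart \<open>c\<close>
  around \<open>x\<close>.\<close>

definition tangent_map :: "('m, 'e::euclidean_space) chart set \<Rightarrow> ('m \<Rightarrow> 'm) \<Rightarrow>
    'm \<times> (('m, 'e) chart \<Rightarrow> 'e) \<Rightarrow> 'm \<times> (('m, 'e) chart \<Rightarrow> 'e)" where
  "tangent_map A f = (\<lambda>(x, v).
     (f x, \<lambda>d. if d \<in> A \<and> f x \<in> fst d
        then let c = (SOME c. c \<in> A \<and> x \<in> fst c)
             in frechet_derivative (snd d \<circ> f \<circ> inv_into (fst c) (snd c)) (at (snd c x)) (v c)
        else 0))"

definition tangent_bundle ::
    "'m topology \<Rightarrow> ('m, 'e::euclidean_space) chart set \<Rightarrow> ('g \<Rightarrow> 'm \<Rightarrow> 'm) \<Rightarrow>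
     ('m, 'g, 'm \<times> (('m, 'e) chart \<Rightarrow> 'e)) equivariant_bundle" where
  "tangent_bundle X A \<rho> =
    \<lparr>total = tangent_topology X A,
     proj = fst,
     vadd = (\<lambda>(x, v) (y, w). (x, \<lambda>c. v c + w c)),
     vscale = (\<lambda>s (x, v). (x, \<lambda>c. s *\<^sub>R v c)),
     gact = (\<lambda>t. tangent_map A (\<rho> t))\<rparr>"

section \<open>The dual complex and colorings\<close>

definition facet_enumeration :: "'p::euclidean_space set \<Rightarrow> nat \<Rightarrow> (nat \<Rightarrow> 'p set) \<Rightarrow> bool" where
  "facet_enumeration P m F \<longleftrightarrow> bij_betw F {1..m} {G. G facet_of P}"

definition dual_complex :: "nat \<Rightarrow> (nat \<Rightarrow> 'p set) \<Rightarrow> nat set set" where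
  "dual_complex m F = insert {} {\<alpha>. \<alpha> \<noteq> {} \<and> \<alpha> \<subseteq> {1..m} \<and> (\<Inter>i\<in>\<alpha>. F i) \<noteq> {}}"

definition is_coloring :: "nat \<Rightarrow> nat set set \<Rightarrow> nat \<Rightarrow> (nat \<Rightarrow> nat) \<Rightarrow> bool" where
  "is_coloring m K r \<kappa> \<longleftrightarrow> \<kappa> \<in> {1..m} \<rightarrow> {1..r} \<and> (\<forall>\<alpha>\<in>K. inj_on \<kappa> \<alpha>)"

end

theory Submission
  imports Defs
begin

text \<open>Over the relative interior of a facet \<open>F\<close> all points have the same isotropy group, a circle
  \<open>T\<^sub>F\<close>; at a point over several facets these circles are distinct coordinate circles of a standard
  chart.  Let \<open>t\<^sub>F \<in> T\<^sub>F\<close> have order \<open>4\<close>.  On the tangent space at a point over \<open>F\<close> it acts as a quarter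
  turn of one complex coordinate and trivially on the others, so \<open>(t\<^sub>F - 1)(t\<^sub>F\<^sup>2 + 1) = 0\<close> there, and
  hence also on every \<open>\<xi>\<^sub>j\<close>.  As \<open>\<xi>\<^sub>j\<close> has rank \<open>2\<close>, at each point either \<open>t\<^sub>F = 1\<close> or \<open>t\<^sub>F\<^sup>2 = -1\<close> on
  its fibre.  Both conditions are closed and invariant, so by connectedness of \<open>F\<close> the same alternative
  holds over all of \<open>F\<close>, and the second one holds for some \<open>j\<close>, the color of \<open>F\<close>.  If \<open>F\<close> and \<open>G\<close> meet and
  have the same color \<open>j\<close>, then \<open>t\<^sub>F\<^sup>2\<close> and \<open>t\<^sub>G\<^sup>2\<close> are both \<open>-1\<close> on a fibre of \<open>\<xi>\<^sub>j\<close>; but no nonzero stable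
  tangent vector has this property, since they move different coordinates.\<close>

section \<open>Fibres of equivariant bundles\<close>

lemma torus_mult: "s \<in> torus \<Longrightarrow> t \<in> torus \<Longrightarrow> s * t \<in> torus"
  by (simp add: torus_def norm_mult)

lemma one_in_torus: "1 \<in> torus"
  by (simp add: torus_def)

lemma continuous_torus_action_map:
  assumes "continuous_torus_action X \<rho>" "t \<in> torus"
  shows "continuous_map X X (\<rho> t)"
proof -
  have "continuous_map X (prod_topology (top_of_set torus) X) (\<lambda>x. (t, x))"
    using assms(2) by (intro continuous_map_pairedI) auto
  then have "continuous_map X X ((\<lambda>(t, x). \<rho> t x) \<circ> (\<lambda>x. (t, x)))"
    using assms(1) unfolding continuous_torus_action_def by (blast intro: continuous_map_compose)
  then show ?thesis by (simp add: o_def)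
qed

definition fibre :: "('b, 'g, 'e) equivariant_bundle \<Rightarrow> 'b \<Rightarrow> 'e set" where
  "fibre B x = {u \<in> topspace (total B). proj B u = x}"

lemma fibre_whitney_sum: "fibre (whitney_sum B C) x = fibre B x \<times> fibre C x"
  by (auto simp: fibre_def whitney_sum_def)

lemma fibre_trivial_bundle:
  "x \<in> topspace X \<Longrightarrow> fibre (trivial_bundle X \<rho> k) x = topspace (Euclidean_space k) \<times> {x}"
  by (auto simp: fibre_def trivial_bundle_def)

lemma fibre_whitney_sum_family:
  "r \<ge> 1 \<Longrightarrow> fibre (whitney_sum_family r \<xi>) x = (\<Pi>\<^sub>E j\<in>{1..r}. fibre (\<xi> j) x)"
proof (intro set_eqI)
  fix w assume "r \<ge> 1"
  then have "(\<forall>j\<in>{1..r}. proj (\<xi> j) (w j) = proj (\<xi> 1) (w 1)) \<and> proj (\<xi> 1) (w 1) = x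
      \<longleftrightarrow> (\<forall>j\<in>{1..r}. proj (\<xi> j) (w j) = x)"
    by (metis atLeastAtMost_iff order_refl)
  then show "w \<in> fibre (whitney_sum_family r \<xi>) x \<longleftrightarrow> w \<in> (\<Pi>\<^sub>E j\<in>{1..r}. fibre (\<xi> j) x)"
    unfolding fibre_def whitney_sum_family_def PiE_iff
    by (simp only: equivariant_bundle.select_convs topspace_subtopology topspace_product_topology
        PiE_iff Int_iff mem_Collect_eq) blast
qed

text \<open>A trivialisation sends the slice over a point into the fibre over that point, so its
  bijectivity over \<open>U\<close> splits into bijectivity on single fibres. Both conditions on
  \<open>x\<close> occur because \<open>U\<close> by itself need not lie in the base.\<close>

lemma local_trivialisation_fibre:
  assumes h: "local_trivialisation X k B U h" and x: "x \<in> U" "x \<in> topspace X"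
  shows "bij_betw (\<lambda>a. h (x, a)) (topspace (Euclidean_space k)) (fibre B x)"
proof -
  let ?E = "topspace (Euclidean_space k)"
  have hom: "homeomorphic_map (prod_topology (subtopology X U) (Euclidean_space k))
       (subtopology (total B) {e. proj B e \<in> U}) h"
    and pr: "\<And>x a. x \<in> U \<Longrightarrow> a \<in> ?E \<Longrightarrow> proj B (h (x, a)) = x"
    using h unfolding local_trivialisation_def by auto
  have inj: "inj_on h ((topspace X \<inter> U) \<times> ?E)"
    using homeomorphic_imp_injective_map[OF hom] by simp
  have surj: "h ` ((topspace X \<inter> U) \<times> ?E) = topspace (total B) \<inter> {e. proj B e \<in> U}"
    using homeomorphic_imp_surjective_map[OF hom] by simp
  have "inj_on (\<lambda>a. h (x, a)) ?E"
    using inj x by (auto simp: inj_on_def)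
  moreover have "(\<lambda>a. h (x, a)) ` ?E = fibre B x"
  proof
    show "(\<lambda>a. h (x, a)) ` ?E \<subseteq> fibre B x"
      using surj pr x unfolding fibre_def by blast
  next
    show "fibre B x \<subseteq> (\<lambda>a. h (x, a)) ` ?E"
    proof
      fix e assume e: "e \<in> fibre B x"
      then have "e \<in> h ` ((topspace X \<inter> U) \<times> ?E)"
        using surj x by (auto simp: fibre_def)
      then obtain y a where "y \<in> U" "a \<in> ?E" "e = h (y, a)" by auto
      then show "e \<in> (\<lambda>a. h (x, a)) ` ?E"
        using pr e by (auto simp: fibre_def)
    qed
  qed
  ultimately show ?thesis by (simp add: bij_betw_def)
qed

lemma local_trivialisation_linear:
  assumes "local_trivialisation X k B U h" "x \<in> U"
    "a \<in> topspace (Euclidean_space k)" "b \<in> topspace (Euclidean_space k)"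
  shows "h (x, \<lambda>i. a i + b i) = vadd B (h (x, a)) (h (x, b))"
    and "h (x, \<lambda>i. s * a i) = vscale B s (h (x, a))"
  using assms unfolding local_trivialisation_def by auto

lemma gact_fibre:
  assumes "equivariant_vector_bundle X \<rho> k B" "t \<in> torus" "e \<in> fibre B x"
  shows "gact B t e \<in> fibre B (\<rho> t x)"
proof -
  have act: "continuous_torus_action (total B) (gact B)"
    using assms(1) by (simp add: equivariant_vector_bundle_def)
  have "gact B t e \<in> topspace (total B)"
    using continuous_torus_action_map[OF act assms(2)] assms(3)
    by (auto simp: fibre_def continuous_map_def)
  then show ?thesis
    using assms by (auto simp: fibre_def equivariant_vector_bundle_def)
qed

lemma gact_linear:
  assumes "equivariant_vector_bundle X \<rho> k B" "t \<in> torus" "e \<in> fibre B x"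
  shows "e' \<in> fibre B x \<Longrightarrow> gact B t (vadd B e e') = vadd B (gact B t e) (gact B t e')"
    and "gact B t (vscale B s e) = vscale B s (gact B t e)"
  using assms by (auto simp: fibre_def equivariant_vector_bundle_def)

lemma gact_mult:
  assumes "equivariant_vector_bundle X \<rho> k B" "s \<in> torus" "t \<in> torus" "e \<in> fibre B x"
  shows "gact B (s * t) e = gact B s (gact B t e)"
  using assms by (auto simp: fibre_def equivariant_vector_bundle_def continuous_torus_action_def)

text \<open>Fibres carry no vector space type, only the operations of the record. Coordinates in
  \<open>real \<times> real\<close> make \<open>linear\<close> and determinants available for maps
  of a fibre.\<close>

lemma plane_fibre:
  assumes "equivariant_vector_bundle X \<rho> 2 B" "x \<in> topspace X"
  obtains g :: "real \<times> real \<Rightarrow> _" where "bij_betw g UNIV (fibre B x)"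
    "\<And>p q. g (p + q) = vadd B (g p) (g q)" "\<And>s p. g (s *\<^sub>R p) = vscale B s (g p)"
proof -
  obtain U h where U: "x \<in> U" and h: "local_trivialisation X 2 B U h"
    using assms unfolding equivariant_vector_bundle_def by blast
  let ?E = "topspace (Euclidean_space 2)"
  define c :: "real \<times> real \<Rightarrow> nat \<Rightarrow> real"
    where "c p = (\<lambda>i. if i = 0 then fst p else if i = 1 then snd p else 0)" for p
  have cE: "c p \<in> ?E" for p
    by (auto simp: c_def topspace_Euclidean_space)
  have "bij_betw c UNIV ?E"
  proof (rule bij_betwI[where g = "\<lambda>a. (a 0, a 1)"])
    fix a :: "nat \<Rightarrow> real" assume a: "a \<in> ?E"
    show "c (a 0, a 1) = a"
    proof
      fix i
      have "a i = 0" if "i \<ge> 2" using a that by (auto simp: topspace_Euclidean_space)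
      then show "c (a 0, a 1) i = a i"
        by (cases "i = 0"; cases "i = 1") (auto simp: c_def)
    qed
  qed (use cE in \<open>auto simp: c_def\<close>)
  then have b: "bij_betw (\<lambda>p. h (x, c p)) UNIV (fibre B x)"
    using bij_betw_trans[OF _ local_trivialisation_fibre[OF h U assms(2)], of c UNIV]
    unfolding o_def by blast
  have c: "c (p + q) = (\<lambda>i. c p i + c q i)" "c (s *\<^sub>R p) = (\<lambda>i. s * c p i)" for p q s
    by (auto simp: c_def)
  show ?thesis
  proof (rule that[OF b])
    show "h (x, c (p + q)) = vadd B (h (x, c p)) (h (x, c q))" for p q
      unfolding c(1) by (rule local_trivialisation_linear(1)[OF h U cE cE])
    show "h (x, c (s *\<^sub>R p)) = vscale B s (h (x, c p))" for s p
      unfolding c(2) by (rule local_trivialisation_linear(2)[OF h U cE cE])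
  qed
qed

section \<open>Linear algebra in a real plane\<close>

lemma parallel_projection:
  fixes a b c d l :: real
  assumes "a * d - b * c = 0" "(a * a + b * b) * l = a * c + b * d"
  shows "(a * a + b * b) * c = ((a * a + b * b) * l) * a"
    and "(a * a + b * b) * d = ((a * a + b * b) * l) * b"
  \<comment> \<open>After substituting for the product with \<open>l\<close>, the sides differ by
    \<open>- b\<close> and by \<open>a\<close> times the determinant
    \<open>a * d - b * c\<close>.\<close>
  using assms by algebra+

text \<open>The hypothesis is \<open>(T - 1)(T^2 + 1) = 0\<close>. If \<open>T\<close> is not the
  identity, then \<open>w = T v0 - v0\<close> is a nonzero vector killed by \<open>T^2 + 1\<close>.
  It is no eigenvector, as a real eigenvalue would have square \<open>-1\<close>, so
  \<open>w\<close> and \<open>T w\<close> span the plane and \<open>T^2 = -1\<close> on all of it.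
  In dimension three a quarter turn about an axis would violate the dichotomy.\<close>

lemma plane_rotation_dichotomy:
  fixes T :: "real \<times> real \<Rightarrow> real \<times> real"
  assumes "linear T" and eq: "\<And>v. T (T (T v)) + T v = T (T v) + v"
  shows "(\<forall>v. T v = v) \<or> (\<forall>v. T (T v) = - v)"
proof (cases "\<forall>v. T v = v")
  case False
  then obtain v0 where v0: "T v0 \<noteq> v0" by auto
  interpret linear T by fact
  define w where "w = T v0 - v0"
  have w0: "w \<noteq> 0" using v0 by (simp add: w_def)
  have "T (T w) + w = 0"
    using eq[of v0] by (simp add: w_def diff algebra_simps)
  then have TTw: "T (T w) = - w" by (simp add: eq_neg_iff_add_eq_0)
  \<comment> \<open>The determinant of \<open>w\<close> and \<open>T w\<close>, which vanishes only
    if they are parallel.\<close>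
  define D where "D = fst w * snd (T w) - snd w * fst (T w)"
  have "D \<noteq> 0"
  proof
    assume D: "D = 0"
    define n where "n = fst w * fst w + snd w * snd w"
    define l where "l = (fst w * fst (T w) + snd w * snd (T w)) / n"
    have n: "n \<noteq> 0"
      using w0 by (auto simp: n_def prod_eq_iff sum_squares_eq_zero_iff)
    have "n * l = fst w * fst (T w) + snd w * snd (T w)"
      using n by (simp add: l_def)
    then have "n *\<^sub>R T w = (n * l) *\<^sub>R w"
      using parallel_projection[OF D[unfolded D_def]] by (simp add: n_def prod_eq_iff)
    then have "n *\<^sub>R (T w - l *\<^sub>R w) = 0"
      by (simp add: algebra_simps)
    then have Tw: "T w = l *\<^sub>R w" using n by simp
    then have "- w = (l * l) *\<^sub>R w" using TTw by (simp add: scale)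
    then have "(l * l + 1) *\<^sub>R w = 0" by (simp add: algebra_simps add_eq_0_iff)
    then have "l * l + 1 = 0" using w0 by simp
    then show False using zero_le_square[of l] by linarith
  qed
  have "T (T v) = - v" for v
  proof -
    \<comment> \<open>Cramer's rule for the coordinates of \<open>v\<close> in the basis
      \<open>w\<close>, \<open>T w\<close>.\<close>
    define \<alpha> \<beta> where "\<alpha> = (fst v * snd (T w) - snd v * fst (T w)) / D"
      and "\<beta> = (fst w * snd v - snd w * fst v) / D"
    have "D *\<^sub>R v = (D * \<alpha>) *\<^sub>R w + (D * \<beta>) *\<^sub>R T w"
      using \<open>D \<noteq> 0\<close> unfolding \<alpha>_def \<beta>_def
      by (simp add: prod_eq_iff D_def) (simp add: algebra_simps)
    then have "D *\<^sub>R (v - (\<alpha> *\<^sub>R w + \<beta> *\<^sub>R T w)) = 0"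
      by (simp add: algebra_simps)
    then have "v = \<alpha> *\<^sub>R w + \<beta> *\<^sub>R T w" using \<open>D \<noteq> 0\<close> by simp
    moreover have "T (T (\<alpha> *\<^sub>R w + \<beta> *\<^sub>R T w)) = - (\<alpha> *\<^sub>R w + \<beta> *\<^sub>R T w)"
      by (simp add: add diff scale TTw neg)
    ultimately show ?thesis by simp
  qed
  then show ?thesis by blast
qed simp

text \<open>Both alternatives say that a torus element acts on the fibre as a scalar,
  \<open>t\<close> as \<open>1\<close> or \<open>t * t\<close> as \<open>-1\<close>; this common
  form is the one treated by \<open>closedin_scalar_action\<close>.\<close>

lemma plane_bundle_dichotomy:
  assumes B: "equivariant_vector_bundle X \<rho> 2 B" and x: "x \<in> topspace X"
    and t: "t \<in> torus" "\<rho> t x = x"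
    and eq: "\<And>e. e \<in> fibre B x \<Longrightarrow>
      vadd B (gact B t (gact B t (gact B t e))) (gact B t e) = vadd B (gact B t (gact B t e)) e"
  shows "(\<forall>e\<in>fibre B x. gact B t e = vscale B 1 e) \<or>
    (\<forall>e\<in>fibre B x. gact B (t * t) e = vscale B (-1) e)"
proof -
  obtain g :: "real \<times> real \<Rightarrow> _" where g: "bij_betw g UNIV (fibre B x)"
    and ga: "\<And>p q. g (p + q) = vadd B (g p) (g q)" and gs: "\<And>s p. g (s *\<^sub>R p) = vscale B s (g p)"
    by (rule plane_fibre[OF B x]) blast
  have gf: "g p \<in> fibre B x" for p using g by (auto simp: bij_betw_def)
  have inj: "g p = g q \<longleftrightarrow> p = q" for p q
    using g unfolding bij_betw_def by (metis injD)
  have surj: "\<exists>p. e = g p" if "e \<in> fibre B x" for e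
    using g that unfolding bij_betw_def by (metis rangeE)
  define T where "T p = inv g (gact B t (g p))" for p
  have gT: "gact B t (g p) = g (T p)" for p
  proof -
    have "gact B t (g p) \<in> fibre B x" using gact_fibre[OF B t(1) gf[of p]] t(2) by simp
    then have "gact B t (g p) \<in> range g" using g by (simp add: bij_betw_def)
    then show ?thesis unfolding T_def by (simp add: f_inv_into_f)
  qed
  have "linear T"
  proof
    show "T (p + q) = T p + T q" for p q
      using gact_linear(1)[OF B t(1) gf gf] by (simp flip: inj gT add: ga)
    show "T (s *\<^sub>R p) = s *\<^sub>R T p" for s p
      using gact_linear(2)[OF B t(1) gf] by (simp flip: inj gT add: gs)
  qed
  moreover have "T (T (T v)) + T v = T (T v) + v" for v
    using eq[OF gf[of v]] by (simp flip: inj gT add: ga)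
  ultimately consider "\<And>v. T v = v" | "\<And>v. T (T v) = - v"
    using plane_rotation_dichotomy by blast
  then show ?thesis
  proof cases
    case 1
    then have "gact B t e = vscale B 1 e" if e: "e \<in> fibre B x" for e
    proof -
      obtain p where "e = g p" using surj[OF e] by blast
      then show ?thesis using gT[of p] gs[of 1 p] 1[of p] by simp
    qed
    then show ?thesis by blast
  next
    case 2
    then have "gact B (t * t) e = vscale B (-1) e" if e: "e \<in> fibre B x" for e
    proof -
      obtain p where "e = g p" using surj[OF e] by blast
      then show ?thesis
        using gT[of p] gT[of "T p"] gs[of "-1" p] 2[of p] gact_mult[OF B t(1) t(1) e] by simp
    qed
    then show ?thesis by blast
  qed
qed

text \<open>The image of \<open>(1, 0)\<close> serves. It is nonzero and differs from its negative,
  which separates the two alternatives of the dichotomy.\<close>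

lemma plane_bundle_nonzero:
  assumes B: "equivariant_vector_bundle X \<rho> 2 B" and x: "x \<in> topspace X"
  obtains e where "e \<in> fibre B x" "vscale B 0 e \<noteq> e" "vscale B 1 e \<noteq> vscale B (-1) e"
    "vscale B 1 e = e"
proof -
  obtain g :: "real \<times> real \<Rightarrow> _" where g: "bij_betw g UNIV (fibre B x)"
    and gs: "\<And>s p. g (s *\<^sub>R p) = vscale B s (g p)"
    by (rule plane_fibre[OF B x]) blast
  have "g p = g q \<longleftrightarrow> p = q" for p q
    using g unfolding bij_betw_def by (metis injD)
  moreover have "g p \<in> fibre B x" for p using g by (auto simp: bij_betw_def)
  ultimately show ?thesis
    using that[of "g (1, 0)"] by (simp flip: gs add: zero_prod_def)
qed

text \<open>Vector space laws pass from the model space to the fibre through a trivialisation. The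
  last one identifies \<open>vscale B 0 e\<close> as the zero vector of the fibre.\<close>

lemma vscale_fibre:
  assumes B: "equivariant_vector_bundle X \<rho> k B" and x: "x \<in> topspace X" and e: "e \<in> fibre B x"
  shows "vscale B s e \<in> fibre B x" "vscale B 1 e = e" "vscale B s (vscale B s' e) = vscale B (s * s') e"
    "e' \<in> fibre B x \<Longrightarrow> vscale B 0 e = vscale B 0 e'"
proof -
  let ?E = "topspace (Euclidean_space k)"
  obtain U h where U: "x \<in> U" and h: "local_trivialisation X k B U h"
    using B x unfolding equivariant_vector_bundle_def by blast
  note b = local_trivialisation_fibre[OF h U x] and lin = local_trivialisation_linear[OF h U]
  have sE: "(\<lambda>i. s * a i) \<in> ?E" if "a \<in> ?E" for s and a :: "nat \<Rightarrow> real"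
    using that by (auto simp: topspace_Euclidean_space)
  obtain a where a: "a \<in> ?E" "e = h (x, a)" using b e by (auto simp: bij_betw_def)
  have "h (x, \<lambda>i. s * a i) \<in> fibre B x" using b sE[OF a(1)] by (auto simp: bij_betw_def)
  then show "vscale B s e \<in> fibre B x" using lin(2)[OF a(1) a(1), of s] a by simp
  show "vscale B 1 e = e" using lin(2)[OF a(1) a(1), of 1, symmetric] a by simp
  show "vscale B s (vscale B s' e) = vscale B (s * s') e"
    using lin(2)[OF sE[OF a(1), of s'] a(1), of s, symmetric]
      lin(2)[OF a(1) a(1), of s', symmetric] lin(2)[OF a(1) a(1), of "s * s'", symmetric] a by (simp add: mult.assoc)
  assume "e' \<in> fibre B x"
  then obtain a' where a': "a' \<in> ?E" "e' = h (x, a')" using b by (auto simp: bij_betw_def)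
  show "vscale B 0 e = vscale B 0 e'"
    using lin(2)[OF a(1) a(1), of 0, symmetric] lin(2)[OF a'(1) a'(1), of 0, symmetric] a a'
    by simp
qed

text \<open>Closedness is checked locally. A trivialisation replaces the vectors of a varying fibre
  by fixed coordinate vectors \<open>a\<close>, and for each \<open>a\<close> the condition becomes
  equality of two continuous functions of the base point. Only over fixed points of \<open>t\<close>
  do both values lie in the same fibre, hence the restriction to the closed set of fixed
  points.\<close>

lemma closedin_scalar_action:
  assumes B: "equivariant_vector_bundle X \<rho> k B" and X: "Hausdorff_space X"
    and act: "continuous_torus_action X \<rho>" and t: "t \<in> torus"
  shows "closedin X {x \<in> topspace X. \<rho> t x = x \<and> (\<forall>e\<in>fibre B x. gact B t e = vscale B s e)}"
    (is "closedin X ?C")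
proof -
  let ?E = "topspace (Euclidean_space k)"
  let ?M = "{x \<in> topspace X. \<rho> t x = x}"
  have M: "closedin X ?M"
    using closedin_continuous_maps_eq[OF X continuous_torus_action_map[OF act t] continuous_map_id]
    by simp
  have loc: "\<exists>U. openin X U \<and> x \<in> U \<and> closedin (subtopology X U) (?C \<inter> U)"
    if x: "x \<in> topspace X" for x
  proof -
    obtain U h where U: "openin X U" "x \<in> U" and h: "local_trivialisation X k B U h"
      using B x unfolding equivariant_vector_bundle_def by blast
    let ?W = "subtopology X (?M \<inter> U)"
    let ?Y = "subtopology (total B) {e. proj B e \<in> U}"
    have UX: "U \<subseteq> topspace X" using U openin_subset by blast
    have hom: "homeomorphic_map (prod_topology (subtopology X U) (Euclidean_space k)) ?Y h"
      and pr: "\<And>x a. x \<in> U \<Longrightarrow> a \<in> ?E \<Longrightarrow> proj B (h (x, a)) = x"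
      using h unfolding local_trivialisation_def by auto
    \<comment> \<open>Closedness of equality sets relies on a Hausdorff target; the part of the
      total space over \<open>U\<close> is homeomorphic to a product of Hausdorff spaces.\<close>
    have "Hausdorff_space (Euclidean_space k)"
      by (simp add: Euclidean_space_def Hausdorff_space_subtopology Hausdorff_space_product_topology)
    then have "Hausdorff_space (prod_topology (subtopology X U) (Euclidean_space k))"
      by (simp add: Hausdorff_space_prod_topology Hausdorff_space_subtopology X)
    then have Y: "Hausdorff_space ?Y"
      using hom homeomorphic_Hausdorff_space homeomorphic_map_imp_homeomorphic_space by blast
    have hc: "continuous_map ?W ?Y (\<lambda>y. h (y, a))" if a: "a \<in> ?E" for a
    proof -
      have "continuous_map ?W (prod_topology (subtopology X U) (Euclidean_space k)) (\<lambda>y. (y, a))"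
        using a by (intro continuous_map_pairedI)
          (auto simp: continuous_map_in_subtopology continuous_map_from_subtopology)
      then have "continuous_map ?W ?Y (h \<circ> (\<lambda>y. (y, a)))"
        using homeomorphic_imp_continuous_map[OF hom] continuous_map_compose by blast
      then show ?thesis by (simp add: o_def)
    qed
    have gc: "continuous_map ?W ?Y (\<lambda>y. gact B t (h (y, a)))" if a: "a \<in> ?E" for a
    proof -
      have cta: "continuous_torus_action (total B) (gact B)"
        using B by (simp add: equivariant_vector_bundle_def)
      have "continuous_map ?W (total B) (gact B t \<circ> (\<lambda>y. h (y, a)))"
        using hc[OF a] continuous_torus_action_map[OF cta t]
        by (meson continuous_map_compose continuous_map_in_subtopology)
      moreover have "proj B (gact B t (h (y, a))) = y" if "y \<in> ?M \<inter> U" for y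
      proof -
        have "h (y, a) \<in> fibre B y"
          using local_trivialisation_fibre[OF h, of y] that a UX by (auto simp: bij_betw_def)
        from gact_fibre[OF B t this] that show ?thesis by (simp add: fibre_def)
      qed
      ultimately show ?thesis
        by (auto simp: continuous_map_in_subtopology o_def)
    qed
    have sE: "(\<lambda>i. s * a i) \<in> ?E" if "a \<in> ?E" for a :: "nat \<Rightarrow> real"
      using that by (auto simp: topspace_Euclidean_space)
    have cl: "closedin ?W {y \<in> topspace ?W. gact B t (h (y, a)) = h (y, \<lambda>i. s * a i)}"
      if "a \<in> ?E" for a
      using closedin_continuous_maps_eq[OF Y gc[OF that] hc[OF sE[OF that]]] .
    have ne: "?E \<noteq> {}" by (auto simp: topspace_Euclidean_space)
    have eq: "?C \<inter> U = (\<Inter>a\<in>?E. {y \<in> topspace ?W. gact B t (h (y, a)) = h (y, \<lambda>i. s * a i)})"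
    proof -
      have "(\<forall>e\<in>fibre B y. gact B t e = vscale B s e) \<longleftrightarrow>
          (\<forall>a\<in>?E. gact B t (h (y, a)) = h (y, \<lambda>i. s * a i))" if y: "y \<in> U" for y
      proof -
        have "fibre B y = (\<lambda>a. h (y, a)) ` ?E"
          using local_trivialisation_fibre[OF h y] y UX by (auto simp: bij_betw_def)
        moreover have "h (y, \<lambda>i. s * a i) = vscale B s (h (y, a))" if "a \<in> ?E" for a
          using local_trivialisation_linear(2)[OF h y that that] .
        ultimately show ?thesis by auto
      qed
      then have key: "y \<in> ?C \<longleftrightarrow> (\<forall>a\<in>?E. gact B t (h (y, a)) = h (y, \<lambda>i. s * a i))"
        if "y \<in> ?M" "y \<in> U" for y using that by simp
      have W: "topspace ?W = ?M \<inter> U" by auto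
      have "?C \<subseteq> ?M" by blast
      then show ?thesis unfolding W using key ne by (intro equalityI subsetI) blast+
    qed
    have "closedin ?W (?C \<inter> U)"
      unfolding eq using cl ne by (intro closedin_Inter) auto
    moreover have "closedin (subtopology X U) (?M \<inter> U)"
      using M by (metis closedin_subtopology)
    ultimately have "closedin (subtopology X U) (?C \<inter> U)"
      using closedin_trans_full[of "subtopology X U" "?M \<inter> U" "?C \<inter> U"]
      by (simp add: subtopology_subtopology Int_commute Int_left_commute)
    then show ?thesis using U by blast
  qed
  have "openin X (topspace X - ?C)"
  proof (subst openin_subopen, intro ballI)
    fix x assume x: "x \<in> topspace X - ?C"
    obtain U where U: "openin X U" "x \<in> U" "closedin (subtopology X U) (?C \<inter> U)"
      using loc x by blast
    have "openin (subtopology X U) (topspace (subtopology X U) - ?C \<inter> U)"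
      by (rule openin_diff[OF openin_topspace U(3)])
    then have "openin X (topspace (subtopology X U) - ?C \<inter> U)"
      by (rule openin_trans_full[OF _ U(1)])
    moreover have "x \<in> topspace (subtopology X U) - ?C \<inter> U" using x U by auto
    moreover have "topspace (subtopology X U) - ?C \<inter> U \<subseteq> topspace X - ?C" by auto
    ultimately show "\<exists>T. openin X T \<and> x \<in> T \<and> T \<subseteq> topspace X - ?C" by blast
  qed
  then show ?thesis
    by (auto simp: closedin_def)
qed

section \<open>The isotropy representation on tangent spaces\<close>

lemma chart_inv_into:
  assumes "is_chart X c" "y \<in> fst c"
  shows "inv_into (fst c) (snd c) (snd c y) = y"
proof -
  have "fst c \<subseteq> topspace X"
    using assms(1) openin_subset by (auto simp: is_chart_def)
  then have "inj_on (snd c) (fst c)"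
    using assms(1) homeomorphic_imp_injective_map unfolding is_chart_def
    by (metis topspace_subtopology_subset)
  then show ?thesis using assms(2) by simp
qed

lemma open_chart_image:
  assumes c: "is_chart X c" and U: "openin X U"
  shows "open (snd c ` (fst c \<inter> U))"
proof -
  have "openin (subtopology X (fst c)) (fst c \<inter> U)"
    using U by (simp add: openin_subtopology_Int2)
  moreover have "open_map (subtopology X (fst c)) (top_of_set (snd c ` fst c)) (snd c)"
    using c homeomorphic_imp_open_map by (auto simp: is_chart_def)
  ultimately have "openin (top_of_set (snd c ` fst c)) (snd c ` (fst c \<inter> U))"
    by (simp add: open_map_def)
  then show ?thesis
    using c by (auto simp: is_chart_def intro: openin_open_trans)
qed

lemma openin_chart_vimage:
  assumes c: "is_chart X c" and W: "open W"
  shows "openin X {y \<in> fst c. snd c y \<in> W}"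
proof -
  have c': "openin X (fst c)" "continuous_map (subtopology X (fst c)) euclidean (snd c)"
    using c homeomorphic_imp_continuous_map unfolding is_chart_def
    by (blast, metis continuous_map_into_fulltopology)
  then have "openin (subtopology X (fst c)) {y \<in> topspace (subtopology X (fst c)). snd c y \<in> W}"
    using W openin_continuous_map_preimage[OF c'(2), of W] by simp
  moreover have "topspace (subtopology X (fst c)) = fst c"
    using c'(1) openin_subset by fastforce
  ultimately show ?thesis using c'(1) openin_trans_full by fastforce
qed

lemma transition_chart: "is_chart X c \<Longrightarrow> y \<in> fst c \<Longrightarrow> transition c d (snd c y) = snd d y"
  by (simp add: transition_def chart_inv_into)

lemma compatible_transition_differentiable:
  assumes "compatible c d" "y \<in> fst c" "y \<in> fst d"
  shows "transition c d differentiable (at (snd c y))"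
proof -
  have "Ck_on (Suc 0) (snd c ` (fst c \<inter> fst d)) (transition c d)"
    using assms(1) unfolding compatible_def smooth_on_def by blast
  then show ?thesis using assms(2,3) by simp
qed

lemma compatible_sym: "compatible c d \<longleftrightarrow> compatible d c"
  by (auto simp: compatible_def Int_commute)

lemma atlas_cover:
  assumes "smooth_manifold X A" "x \<in> topspace X"
  obtains c where "c \<in> A" "x \<in> fst c"
proof -
  have "x \<in> (\<Union>c\<in>A. fst c)" using assms unfolding smooth_manifold_def by blast
  then show ?thesis using that by blast
qed

definition transition_deriv :: "('m, 'e::euclidean_space) chart \<Rightarrow> ('m, 'e) chart \<Rightarrow> 'm \<Rightarrow> 'e \<Rightarrow> 'e" where
  "transition_deriv c d y = frechet_derivative (transition c d) (at (snd c y))"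

lemma transition_deriv:
  assumes "compatible c d" "y \<in> fst c" "y \<in> fst d"
  shows "(transition c d has_derivative transition_deriv c d y) (at (snd c y))"
  using compatible_transition_differentiable[OF assms]
  unfolding transition_deriv_def by (simp add: frechet_derivative_works)

lemma linear_transition_deriv:
  assumes "compatible c d" "y \<in> fst c" "y \<in> fst d"
  shows "linear (transition_deriv c d y)"
  using transition_deriv[OF assms] has_derivative_linear by blast

text \<open>Chain rule. The composed transition map is compared with the direct one on the image of
  the triple overlap, which is open, and derivatives are local.\<close>

lemma transition_deriv_compose:
  assumes "is_chart X c" "is_chart X d" "is_chart X e"
    and "compatible c d" "compatible d e" and y: "y \<in> fst c" "y \<in> fst d" "y \<in> fst e"
  shows "transition_deriv d e y (transition_deriv c d y u) = transition_deriv c e y u"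
proof -
  have "(transition c d has_derivative transition_deriv c d y) (at (snd c y))"
    using assms by (intro transition_deriv)
  moreover have "(transition d e has_derivative transition_deriv d e y) (at (transition c d (snd c y)))"
    using assms transition_deriv[of d e y] by (simp add: transition_chart)
  ultimately have "(transition d e \<circ> transition c d has_derivative
      transition_deriv d e y \<circ> transition_deriv c d y) (at (snd c y))"
    by (rule diff_chain_at)
  moreover have "open (snd c ` (fst c \<inter> (fst d \<inter> fst e)))"
    using assms by (intro open_chart_image[of X]) (auto simp: is_chart_def)
  ultimately have "(transition c e has_derivative
      transition_deriv d e y \<circ> transition_deriv c d y) (at (snd c y))"
    by (rule has_derivative_transform_within_open)
      (use assms in \<open>auto simp: transition_chart\<close>)
  then show ?thesis
    unfolding transition_deriv_def[of c e] by (simp flip: frechet_derivative_at)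
qed

lemma transition_deriv_self:
  assumes "is_chart X c" "y \<in> fst c"
  shows "transition_deriv c c y u = u"
proof -
  have "open (snd c ` (fst c \<inter> topspace X))"
    using assms by (intro open_chart_image[of X]) auto
  then have "(transition c c has_derivative (\<lambda>u. u)) (at (snd c y))"
    by (rule has_derivative_transform_within_open[OF has_derivative_ident])
      (use assms openin_subset[of X "fst c"] in \<open>auto simp: transition_chart[of X] is_chart_def\<close>)
  then show ?thesis
    unfolding transition_deriv_def by (simp flip: frechet_derivative_at)
qed

text \<open>Here \<open>c\<close> may be any chart of the maximal atlas, in particular a standard
  one, while the entries of a tangent vector are indexed by the charts in \<open>A\<close>. The
  formula gives the tangent vector whose coordinates in \<open>c\<close> are
  \<open>u\<close>.\<close>

definition tangent_vector :: "('m, 'e::euclidean_space) chart set \<Rightarrow> ('m, 'e) chart \<Rightarrow> 'm \<Rightarrow> 'e \<Rightarrow>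
    'm \<times> (('m, 'e) chart \<Rightarrow> 'e)" where
  "tangent_vector A c y u = (y, \<lambda>d. if d \<in> A \<and> y \<in> fst d then transition_deriv c d y u else 0)"

lemma topspace_tangent_topology:
  assumes "smooth_manifold X A"
  shows "topspace (tangent_topology X A) = tangent_vectors X A"
proof -
  have "topspace (tangent_topology X A) =
      \<Union> {{(x, v). (x, v) \<in> tangent_vectors X A \<and> x \<in> fst c \<and> (snd c x, v c) \<in> W} | c W.
        c \<in> A \<and> open W}"
    by (simp add: tangent_topology_def)
  also have "\<dots> = tangent_vectors X A"
  proof
    show "tangent_vectors X A \<subseteq> \<Union> {{(x, v). (x, v) \<in> tangent_vectors X A \<and> x \<in> fst c \<and> (snd c x, v c) \<in> W} | c W.
        c \<in> A \<and> open W}"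
    proof
      fix p assume p: "p \<in> tangent_vectors X A"
      obtain x v where xv: "p = (x, v)" by (cases p)
      then have "x \<in> topspace X" using p by (auto simp: tangent_vectors_def)
      then obtain c where c: "c \<in> A" "x \<in> fst c"
        using atlas_cover[OF assms] by blast
      have "p \<in> {(x, v). (x, v) \<in> tangent_vectors X A \<and> x \<in> fst c \<and> (snd c x, v c) \<in> UNIV}"
        using p xv c by auto
      then show "p \<in> \<Union> {{(x, v). (x, v) \<in> tangent_vectors X A \<and> x \<in> fst c \<and> (snd c x, v c) \<in> W} | c W.
        c \<in> A \<and> open W}"
        using c(1) open_UNIV by blast
    qed
  qed blast
  finally show ?thesis .
qed

text \<open>One atlas chart \<open>d0\<close> around \<open>y\<close> suffices to recover
  \<open>u\<close>, as the derivatives between \<open>c\<close> and \<open>d0\<close> are mutually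
  inverse by the chain rule. Conversely a tangent vector is determined by its entry at
  \<open>d0\<close>, which supplies the preimage.\<close>

lemma tangent_vector_fibre:
  assumes M: "smooth_manifold X A" and c: "smooth_chart X A c" and y: "y \<in> fst c"
  shows "bij_betw (tangent_vector A c y) UNIV (fibre (tangent_bundle X A \<rho>) y)"
proof -
  have isc: "is_chart X c" and cA: "\<And>d. d \<in> A \<Longrightarrow> compatible c d"
    using c by (auto simp: smooth_chart_def)
  have Ac: "\<And>d. d \<in> A \<Longrightarrow> compatible d c" using cA by (simp add: compatible_sym)
  have isA: "\<And>d. d \<in> A \<Longrightarrow> is_chart X d" and AA: "\<And>d e. d \<in> A \<Longrightarrow> e \<in> A \<Longrightarrow> compatible d e"
    using M by (auto simp: smooth_manifold_def)
  have yX: "y \<in> topspace X" using isc y openin_subset by (auto simp: is_chart_def)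
  obtain d0 where d0: "d0 \<in> A" "y \<in> fst d0"
    using atlas_cover[OF M yX] by blast
  have fib: "fibre (tangent_bundle X A \<rho>) y = {p \<in> tangent_vectors X A. fst p = y}"
    by (simp add: fibre_def tangent_bundle_def topspace_tangent_topology[OF M])
  have "inj (tangent_vector A c y)"
  proof (rule injI)
    fix u u' assume "tangent_vector A c y u = tangent_vector A c y u'"
    then have "snd (tangent_vector A c y u) d0 = snd (tangent_vector A c y u') d0" by simp
    then have "transition_deriv c d0 y u = transition_deriv c d0 y u'"
      using d0 by (simp add: tangent_vector_def)
    then have "transition_deriv d0 c y (transition_deriv c d0 y u) =
        transition_deriv d0 c y (transition_deriv c d0 y u')"
      by simp
    then show "u = u'"
      using transition_deriv_compose[OF isc isA[OF d0(1)] isc cA[OF d0(1)] Ac[OF d0(1)] y d0(2) y]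
        transition_deriv_self[OF isc y] by simp
  qed
  moreover have "range (tangent_vector A c y) = {p \<in> tangent_vectors X A. fst p = y}"
  proof
    have "frechet_derivative (transition d e) (at (snd d y)) (transition_deriv c d y u) = transition_deriv c e y u"
      if "d \<in> A" "e \<in> A" "y \<in> fst d" "y \<in> fst e" for d e u
      using transition_deriv_compose[OF isc isA[OF that(1)] isA[OF that(2)] cA[OF that(1)] AA[OF that(1,2)] y that(3,4)]
      by (simp add: transition_deriv_def)
    then have "tangent_vector A c y u \<in> tangent_vectors X A" for u
      using yX unfolding tangent_vectors_def tangent_vector_def
      by simp
    then show "range (tangent_vector A c y) \<subseteq> {p \<in> tangent_vectors X A. fst p = y}"
      by (auto simp: tangent_vector_def)
  next
    show "{p \<in> tangent_vectors X A. fst p = y} \<subseteq> range (tangent_vector A c y)"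
    proof
      fix p assume "p \<in> {p \<in> tangent_vectors X A. fst p = y}"
      then obtain v where p: "p = (y, v)" "(y, v) \<in> tangent_vectors X A" by (cases p) auto
      have v0: "v d = 0" if "d \<notin> A \<or> y \<notin> fst d" for d
        using p(2) that unfolding tangent_vectors_def by blast
      have v: "v d = transition_deriv d0 d y (v d0)" if "d \<in> A" "y \<in> fst d" for d
        using p(2) that d0 unfolding tangent_vectors_def transition_deriv_def by blast
      have "p = tangent_vector A c y (transition_deriv d0 c y (v d0))"
      proof -
        have "v d = (if d \<in> A \<and> y \<in> fst d then transition_deriv c d y (transition_deriv d0 c y (v d0)) else 0)" for d
          using v0[of d] v[of d]
            transition_deriv_compose[OF isA[OF d0(1)] isc isA[of d] Ac[OF d0(1)] cA[of d] d0(2) y]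
          by auto
        then show ?thesis unfolding p(1) tangent_vector_def by blast
      qed
      then show "p \<in> range (tangent_vector A c y)" by blast
    qed
  qed
  ultimately show ?thesis by (simp add: bij_betw_def fib)
qed

lemma tangent_vector_vadd:
  assumes "smooth_chart X A c" "y \<in> fst c"
  shows "vadd (tangent_bundle X A \<rho>) (tangent_vector A c y u) (tangent_vector A c y v) =
    tangent_vector A c y (u + v)"
  using assms linear_add[OF linear_transition_deriv[of c]]
  by (auto simp: tangent_bundle_def tangent_vector_def fun_eq_iff smooth_chart_def)

lemma tangent_vector_vscale:
  assumes "smooth_chart X A c" "y \<in> fst c"
  shows "vscale (tangent_bundle X A \<rho>) s (tangent_vector A c y u) = tangent_vector A c y (s *\<^sub>R u)"
  using assms linear_cmul[OF linear_transition_deriv[of c]]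
  by (auto simp: tangent_bundle_def tangent_vector_def fun_eq_iff smooth_chart_def)

lemma bounded_linear_vec_mult: "bounded_linear (\<lambda>u :: complex^'n. s * u)"
  by (intro linear_conv_bounded_linear[THEN iffD1] linearI)
    (auto simp: vec_eq_iff distrib_left)

text \<open>In a standard chart \<open>\<rho> t\<close> is multiplication by
  \<open>\<psi> t\<close>, a linear map and thus its own derivative. So the isotropy representation
  at a fixed point is this multiplication in the coordinates of \<open>c\<close>.\<close>

lemma tangent_vector_gact:
  assumes M: "smooth_manifold X A" and c: "standard_chart X A \<rho> c \<psi>" and y: "y \<in> fst c"
    and t: "t \<in> torus" "\<rho> t y = y"
  shows "gact (tangent_bundle X A \<rho>) t (tangent_vector A c y u) = tangent_vector A c y (\<psi> t * u)"
proof -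
  have isc: "is_chart X c" and cA: "\<And>d. d \<in> A \<Longrightarrow> compatible c d"
    and eqv: "\<And>x. x \<in> fst c \<Longrightarrow> \<rho> t x \<in> fst c \<and> snd c (\<rho> t x) = \<psi> t * snd c x"
    using c t by (auto simp: smooth_chart_def standard_chart_def)
  have Ac: "\<And>d. d \<in> A \<Longrightarrow> compatible d c" using cA by (simp add: compatible_sym)
  have isA: "\<And>d. d \<in> A \<Longrightarrow> is_chart X d"
    using M by (auto simp: smooth_manifold_def)
  have yX: "y \<in> topspace X" using isc y openin_subset by (auto simp: is_chart_def)
  \<comment> \<open>The chart selected by \<open>tangent_map\<close> at \<open>y\<close>. It may
    differ from \<open>c\<close>, so the action is factored through \<open>c\<close> near
    \<open>y\<close>.\<close>
  define d0 where "d0 = (SOME d. d \<in> A \<and> y \<in> fst d)"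
  have "\<exists>d. d \<in> A \<and> y \<in> fst d" using atlas_cover[OF M yX] by blast
  from someI_ex[OF this] have d0: "d0 \<in> A" "y \<in> fst d0" by (auto simp: d0_def)
  have fix_y: "\<psi> t * snd c y = snd c y" using eqv[OF y] t(2) by simp
  have "frechet_derivative (snd d \<circ> \<rho> t \<circ> inv_into (fst d0) (snd d0)) (at (snd d0 y)) (transition_deriv c d0 y u)
      = transition_deriv c d y (\<psi> t * u)" if d: "d \<in> A" "y \<in> fst d" for d
  proof -
    have "(transition d0 c has_derivative transition_deriv d0 c y) (at (snd d0 y))"
      using Ac d0 y by (intro transition_deriv) auto
    from diff_chain_at[OF this bounded_linear_imp_has_derivative[OF bounded_linear_vec_mult[of "\<psi> t"]]]
    have 1: "((\<lambda>u. \<psi> t * u) \<circ> transition d0 c has_derivative (\<lambda>u. \<psi> t * u) \<circ> transition_deriv d0 c y)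
      (at (snd d0 y))" .
    have "(transition c d has_derivative transition_deriv c d y)
        (at (((\<lambda>u. \<psi> t * u) \<circ> transition d0 c) (snd d0 y)))"
      using transition_deriv[OF cA[OF d(1)] y d(2)] transition_chart[OF isA d0(2)] d0(1) fix_y by simp
    from diff_chain_at[OF 1 this]
    have 2: "(transition c d \<circ> ((\<lambda>u. \<psi> t * u) \<circ> transition d0 c) has_derivative
        transition_deriv c d y \<circ> ((\<lambda>u. \<psi> t * u) \<circ> transition_deriv d0 c y)) (at (snd d0 y))" .
    have op: "open (snd d0 ` (fst d0 \<inter> fst c))"
      using isA[OF d0(1)] isc by (intro open_chart_image[of X]) (auto simp: is_chart_def)
    have "(snd d \<circ> \<rho> t \<circ> inv_into (fst d0) (snd d0) has_derivative
        transition_deriv c d y \<circ> ((\<lambda>u. \<psi> t * u) \<circ> transition_deriv d0 c y)) (at (snd d0 y))"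
    proof (rule has_derivative_transform_within_open[OF 2 op])
      show "snd d0 y \<in> snd d0 ` (fst d0 \<inter> fst c)" using y d0 by blast
      fix w assume "w \<in> snd d0 ` (fst d0 \<inter> fst c)"
      then obtain x where x: "x \<in> fst d0" "x \<in> fst c" "w = snd d0 x" by blast
      have "transition c d (\<psi> t * snd c x) = snd d (\<rho> t x)"
        using eqv[OF x(2)] transition_chart[OF isc, of "\<rho> t x" d] by simp
      then show "(transition c d \<circ> ((\<lambda>u. \<psi> t * u) \<circ> transition d0 c)) w =
          (snd d \<circ> \<rho> t \<circ> inv_into (fst d0) (snd d0)) w"
        using x transition_chart[OF isA[OF d0(1)] x(1)] chart_inv_into[OF isA[OF d0(1)] x(1)] by simp
    qed
    then have "frechet_derivative (snd d \<circ> \<rho> t \<circ> inv_into (fst d0) (snd d0)) (at (snd d0 y)) =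
        transition_deriv c d y \<circ> ((\<lambda>u. \<psi> t * u) \<circ> transition_deriv d0 c y)"
      by (rule frechet_derivative_at[symmetric])
    moreover have "transition_deriv d0 c y (transition_deriv c d0 y u) = u"
      using transition_deriv_compose[OF isc isA[OF d0(1)] isc cA[OF d0(1)] Ac[OF d0(1)] y d0(2) y]
        transition_deriv_self[OF isc y] by simp
    ultimately show ?thesis by simp
  qed
  then show ?thesis
    using t(2) d0 by (auto simp: tangent_bundle_def tangent_map_def tangent_vector_def Let_def simp flip: d0_def)
qed

section \<open>Isotropy circles of facets\<close>

lemma openin_torus_saturation:
  assumes act: "continuous_torus_action X \<rho>" and U: "openin X U"
  shows "openin X {x \<in> topspace X. \<exists>t\<in>torus. \<rho> t x \<in> U}"
proof -
  have "{x \<in> topspace X. \<exists>t\<in>torus. \<rho> t x \<in> U} = (\<Union>t\<in>torus. {x \<in> topspace X. \<rho> t x \<in> U})"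
    by blast
  also have "openin X \<dots>"
    using continuous_torus_action_map[OF act] U
    by (intro openin_Union) (auto intro: openin_continuous_map_preimage)
  finally show ?thesis .
qed

text \<open>A face of \<open>P\<close> that meets the relative interior of \<open>F\<close> contains
  \<open>F\<close>. Then \<open>F\<close> would be a proper face of \<open>G\<close>, which is
  impossible for equal dimensions.\<close>

lemma rel_interior_facet_unique:
  assumes P: "convex P" and F: "F facet_of P" and G: "G facet_of P"
    and p: "p \<in> rel_interior F" "p \<in> G"
  shows "G = F"
proof (rule ccontr)
  assume ne: "G \<noteq> F"
  have "F \<subseteq> G"
    using subset_of_face_of[of G P F] F G p facet_of_imp_face_of facet_of_imp_subset by blast
  then have "F face_of G"
    using F G by (meson face_of_subset facet_of_imp_face_of facet_of_imp_subset)
  then have "aff_dim F < aff_dim G"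
    using face_of_aff_dim_lt ne G P face_of_imp_convex facet_of_imp_face_of by blast
  then show False using F G by (simp add: facet_of_def)
qed

text \<open>The preimage under \<open>\<psi>\<close> of the \<open>k\<close>-th factor of the torus.
  By \<open>isotropy_single\<close> it is the isotropy group at points whose only vanishing
  coordinate is the \<open>k\<close>-th.\<close>

definition coordinate_circle :: "(complex^'n \<Rightarrow> complex^'n) \<Rightarrow> 'n \<Rightarrow> (complex^'n) set" where
  "coordinate_circle \<psi> k = {t \<in> torus. \<forall>l. l \<noteq> k \<longrightarrow> \<psi> t $ l = 1}"

lemma torus_automorphism_coordinate:
  assumes "torus_automorphism \<psi>" "cmod w = 1"
  obtains t where "t \<in> coordinate_circle \<psi> k" "\<psi> t $ k = w"
proof -
  have "(\<chi> l. if l = k then w else 1) \<in> torus"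
    using assms(2) by (auto simp: torus_def)
  moreover have "\<psi> ` torus = torus"
    using assms(1) by (simp add: torus_automorphism_def bij_betw_def)
  ultimately obtain t where t: "t \<in> torus" "\<psi> t = (\<chi> l. if l = k then w else 1)"
    by (metis imageE)
  then have "t \<in> coordinate_circle \<psi> k" "\<psi> t $ k = w"
    by (auto simp: coordinate_circle_def)
  then show ?thesis using that by blast
qed

lemma inj_coordinate_circle:
  assumes "torus_automorphism \<psi>" "coordinate_circle \<psi> k = coordinate_circle \<psi> l"
  shows "k = l"
proof (rule ccontr)
  assume kl: "k \<noteq> l"
  \<comment> \<open>Any value of modulus one other than \<open>1\<close> would tell the two circles
    apart.\<close>
  obtain t where "t \<in> coordinate_circle \<psi> k" "\<psi> t $ k = -1"
    by (rule torus_automorphism_coordinate[OF assms(1), of "-1"]) auto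
  moreover from this(1) have "t \<in> coordinate_circle \<psi> l"
    using assms(2) by simp
  then have "\<psi> t $ k = 1" using kl by (simp add: coordinate_circle_def)
  ultimately show False by simp
qed

text \<open>\<open>\<psi> 1\<close> is idempotent. Since \<open>complex^'n\<close> can have zero
  divisors, cancellation uses that all coordinates of a torus element are nonzero.\<close>

lemma torus_automorphism_one:
  assumes "torus_automorphism \<psi>"
  shows "\<psi> 1 = 1"
proof -
  have "\<psi> 1 * \<psi> 1 = \<psi> 1"
    using assms one_in_torus unfolding torus_automorphism_def by (metis mult_1)
  moreover have "\<psi> 1 \<in> torus"
    using assms one_in_torus by (auto simp: torus_automorphism_def bij_betw_def)
  then have "\<psi> 1 $ i \<noteq> 0" for i by (auto simp: torus_def dest: spec[of _ i])
  ultimately show ?thesis by (simp add: vec_eq_iff)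
qed

section \<open>The orbit map and the isotropy groups\<close>

locale orbit_space =
  fixes X :: "'m topology" and A :: "('m, complex^'n) chart set"
    and \<rho> :: "complex^'n \<Rightarrow> 'm \<Rightarrow> 'm" and P :: "'p::euclidean_space set" and \<pi> :: "'m \<Rightarrow> 'p"
  assumes polytope: "polytope P"
    and Hausdorff: "Hausdorff_space X"
    and action: "continuous_torus_action X \<rho>"
    and standard: "locally_standard X A \<rho>"
    and proj: "orbit_projection X A \<rho> P \<pi>"
begin

lemma finite_facets: "finite {F. F facet_of P \<and> Q F}"
  using finite_polytope_facets[OF polytope] by (rule rev_finite_subset) auto

lemma pi_surj: "\<pi> ` topspace X = P"
  using proj quotient_imp_surjective_map by (fastforce simp: orbit_projection_def)

lemma pi_eq_iff: "x \<in> topspace X \<Longrightarrow> y \<in> topspace X \<Longrightarrow> \<pi> x = \<pi> y \<longleftrightarrow> (\<exists>t\<in>torus. y = \<rho> t x)"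
  using proj by (auto simp: orbit_projection_def)

lemma act_topspace: "t \<in> torus \<Longrightarrow> x \<in> topspace X \<Longrightarrow> \<rho> t x \<in> topspace X"
  using continuous_torus_action_map[OF action] by (auto simp: continuous_map_def)

lemma act_mult: "s \<in> torus \<Longrightarrow> t \<in> torus \<Longrightarrow> x \<in> topspace X \<Longrightarrow> \<rho> (s * t) x = \<rho> s (\<rho> t x)"
  using action by (auto simp: continuous_torus_action_def)

text \<open>Orbit maps of group actions are open: the preimage of the image of \<open>U\<close> is
  the saturation of \<open>U\<close>.\<close>

lemma pi_open:
  assumes U: "openin X U"
  shows "openin (top_of_set P) (\<pi> ` U)"
proof -
  have UX: "U \<subseteq> topspace X" using U openin_subset by blast
  then have sub: "\<pi> ` U \<subseteq> P" using pi_surj by blast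
  have "{x \<in> topspace X. \<pi> x \<in> \<pi> ` U} = {x \<in> topspace X. \<exists>t\<in>torus. \<rho> t x \<in> U}"
  proof (intro equalityI subsetI)
    fix x assume "x \<in> {x \<in> topspace X. \<pi> x \<in> \<pi> ` U}"
    then obtain y where y: "x \<in> topspace X" "y \<in> U" "\<pi> x = \<pi> y" by blast
    then have "\<exists>t\<in>torus. y = \<rho> t x" using pi_eq_iff[of x y] UX by blast
    then show "x \<in> {x \<in> topspace X. \<exists>t\<in>torus. \<rho> t x \<in> U}" using y by blast
  next
    fix x assume "x \<in> {x \<in> topspace X. \<exists>t\<in>torus. \<rho> t x \<in> U}"
    then obtain t where t: "x \<in> topspace X" "t \<in> torus" "\<rho> t x \<in> U" by blast
    then have "\<pi> x = \<pi> (\<rho> t x)" using pi_eq_iff[of x "\<rho> t x"] act_topspace by blast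
    then show "x \<in> {x \<in> topspace X. \<pi> x \<in> \<pi> ` U}" using t by blast
  qed
  then have "openin X {x \<in> topspace X. \<pi> x \<in> \<pi> ` U}"
    using openin_torus_saturation[OF action U] by simp
  then show ?thesis
    using proj sub unfolding orbit_projection_def quotient_map_def by auto
qed

lemma closedin_pi_vimage:
  assumes "closed S"
  shows "closedin X {x \<in> topspace X. \<pi> x \<in> S}"
proof -
  have "continuous_map X euclidean \<pi>"
    using proj quotient_imp_continuous_map unfolding orbit_projection_def
    by (blast intro: continuous_map_into_fulltopology)
  then show ?thesis using assms by (auto intro: closedin_continuous_map_preimage)
qed

definition isotropy :: "'m \<Rightarrow> (complex^'n) set" where
  "isotropy x = {t \<in> torus. \<rho> t x = x}"

text \<open>The torus is commutative. The inclusion becomes an equality in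
  \<open>isotropy_cong\<close> by exchanging the two points.\<close>

lemma isotropy_orbit:
  assumes "s \<in> torus" "x \<in> topspace X"
  shows "isotropy x \<subseteq> isotropy (\<rho> s x)"
proof
  fix t assume t: "t \<in> isotropy x"
  then have "\<rho> t (\<rho> s x) = \<rho> s (\<rho> t x)"
    using act_mult[OF assms(1) _ assms(2), of t] act_mult[OF _ assms, of t]
    by (simp add: isotropy_def mult.commute)
  then show "t \<in> isotropy (\<rho> s x)" using t by (simp add: isotropy_def)
qed

lemma isotropy_cong:
  assumes "x \<in> topspace X" "y \<in> topspace X" "\<pi> x = \<pi> y"
  shows "isotropy x = isotropy y"
proof
  show "isotropy x \<subseteq> isotropy y"
    using pi_eq_iff[OF assms(1,2)] assms(1,3) isotropy_orbit by auto
  show "isotropy y \<subseteq> isotropy x"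
    using pi_eq_iff[OF assms(2,1)] assms(2,3) isotropy_orbit by auto
qed

lemma standard_chart_facts:
  assumes "standard_chart X A \<rho> c \<psi>"
  shows "is_chart X c" "torus_automorphism \<psi>" "fst c \<subseteq> topspace X"
    "x \<in> fst c \<Longrightarrow> t \<in> torus \<Longrightarrow> \<rho> t x \<in> fst c"
    "x \<in> fst c \<Longrightarrow> t \<in> torus \<Longrightarrow> snd c (\<rho> t x) = \<psi> t * snd c x"
    "x \<in> fst c \<Longrightarrow> card {i. snd c x $ i = 0} = card {F. F facet_of P \<and> \<pi> x \<in> F}"
proof -
  show c: "is_chart X c" "torus_automorphism \<psi>"
    using assms by (auto simp: standard_chart_def smooth_chart_def)
  then show "fst c \<subseteq> topspace X"
    using openin_subset by (auto simp: is_chart_def)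
  show "x \<in> fst c \<Longrightarrow> t \<in> torus \<Longrightarrow> \<rho> t x \<in> fst c"
    "x \<in> fst c \<Longrightarrow> t \<in> torus \<Longrightarrow> snd c (\<rho> t x) = \<psi> t * snd c x"
    using assms by (auto simp: standard_chart_def)
  show "x \<in> fst c \<Longrightarrow> card {i. snd c x $ i = 0} = card {F. F facet_of P \<and> \<pi> x \<in> F}"
    using assms proj unfolding orbit_projection_def by blast
qed

text \<open>The coordinate map is injective and turns the action into multiplication, so
  \<open>t\<close> fixes \<open>x\<close> exactly if it fixes each coordinate.\<close>

lemma isotropy_chart:
  assumes c: "standard_chart X A \<rho> c \<psi>" and x: "x \<in> fst c"
  shows "isotropy x = {t \<in> torus. \<forall>l. snd c x $ l \<noteq> 0 \<longrightarrow> \<psi> t $ l = 1}"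
proof -
  note cf = standard_chart_facts[OF c]
  have "\<rho> t x = x \<longleftrightarrow> \<psi> t * snd c x = snd c x" if t: "t \<in> torus" for t
    using cf(4,5)[OF x t] chart_inv_into[OF cf(1) x] chart_inv_into[OF cf(1) cf(4)[OF x t]] by metis
  then show ?thesis
    by (auto simp: isotropy_def vec_eq_iff)
qed

lemma isotropy_single:
  assumes "standard_chart X A \<rho> c \<psi>" "x \<in> fst c" "{i. snd c x $ i = 0} = {k}"
  shows "isotropy x = coordinate_circle \<psi> k"
  using isotropy_chart[OF assms(1,2)] assms(3) by (auto simp: coordinate_circle_def)

lemma card_facets_rel_interior:
  assumes "F facet_of P" "p \<in> rel_interior F"
  shows "{G. G facet_of P \<and> p \<in> G} = {F}"
proof -
  have "p \<in> F" using assms(2) rel_interior_subset by blast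
  then show ?thesis
    using rel_interior_facet_unique[OF polytope_imp_convex[OF polytope] assms(1) _ assms(2)] assms(1)
    by blast
qed

text \<open>The relative interior is dense in the convex set \<open>F\<close>, and
  \<open>\<pi>\<close> maps neighbourhoods of \<open>x\<close> onto neighbourhoods of
  \<open>\<pi> x\<close> in \<open>P\<close>.\<close>

lemma near_facet_interior:
  assumes U: "openin X U" and x: "x \<in> U" and F: "F facet_of P" "\<pi> x \<in> F"
  obtains z where "z \<in> U" "\<pi> z \<in> rel_interior F"
proof -
  obtain V where V: "open V" "\<pi> ` U = P \<inter> V"
    using pi_open[OF U] by (auto simp: openin_open)
  have cF: "convex F" using F facet_of_imp_face_of face_of_imp_convex by blast
  have FP: "F \<subseteq> P" using F facet_of_imp_subset by blast
  have "\<pi> x \<in> closure (rel_interior F)"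
    using F(2) closure_subset convex_closure_rel_interior[OF cF] by blast
  moreover have "\<pi> x \<in> V" using x V by blast
  ultimately obtain p where p: "p \<in> rel_interior F" "p \<in> V"
    using V(1) by (meson closure_iff_nhds_not_empty disjoint_iff subset_refl)
  then have "p \<in> \<pi> ` U" using V FP rel_interior_subset by blast
  then show ?thesis using that p by blast
qed

text \<open>Only one facet passes through \<open>\<pi> x\<close>, so exactly one coordinate
  vanishes. The inclusion in \<open>{k}\<close> is what points near a given one supply, since
  nonzero coordinates remain nonzero there.\<close>

lemma single_zero_chart:
  assumes "standard_chart X A \<rho> c \<psi>" "x \<in> fst c" "F facet_of P" "\<pi> x \<in> rel_interior F"
    "{i. snd c x $ i = 0} \<subseteq> {k}"
  shows "isotropy x = coordinate_circle \<psi> k"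
proof -
  have "card {i. snd c x $ i = 0} = 1"
    using standard_chart_facts(6)[OF assms(1,2)] card_facets_rel_interior[OF assms(3,4)] by simp
  then have "{i. snd c x $ i = 0} = {k}"
    using assms(5) by (metis card.empty subset_singletonD zero_neq_one)
  then show ?thesis using isotropy_single assms by blast
qed

lemma openin_nonzero_coordinates:
  fixes c :: "('m, complex^'n) chart"
  assumes "is_chart X c"
  shows "openin X {z \<in> fst c. \<forall>l. snd c x $ l \<noteq> 0 \<longrightarrow> snd c z $ l \<noteq> 0}"
proof -
  have "open {u :: complex^'n. \<forall>l. snd c x $ l \<noteq> 0 \<longrightarrow> u $ l \<noteq> 0}"
  proof -
    have "open {u :: complex^'n. u $ l \<noteq> 0}" for l
      by (intro open_Collect_neq continuous_intros)
    then have "open (\<Inter>l\<in>{l. snd c x $ l \<noteq> 0}. {u :: complex^'n. u $ l \<noteq> 0})"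
      by (intro open_INT) auto
    also have "(\<Inter>l\<in>{l. snd c x $ l \<noteq> 0}. {u :: complex^'n. u $ l \<noteq> 0}) =
        {u. \<forall>l. snd c x $ l \<noteq> 0 \<longrightarrow> u $ l \<noteq> 0}"
      by blast
    finally show ?thesis .
  qed
  from openin_chart_vimage[OF assms this] show ?thesis by simp
qed

text \<open>The isotropy group is locally constant over the relative interior: near a point whose
  only vanishing coordinate is the \<open>k\<close>-th, still exactly one coordinate vanishes, and
  it can only be the \<open>k\<close>-th. The relative interior is convex, hence connected.\<close>

lemma facet_isotropy_exists:
  assumes F: "F facet_of P"
  shows "\<exists>H. \<forall>x\<in>topspace X. \<pi> x \<in> rel_interior F \<longrightarrow> isotropy x = H"
proof -
  have cF: "convex F" using F facet_of_imp_face_of face_of_imp_convex by blast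
  have FP: "rel_interior F \<subseteq> P" using F facet_of_imp_subset rel_interior_subset by blast
  define f where "f p = isotropy (SOME x. x \<in> topspace X \<and> \<pi> x = p)" for p
  have f: "f (\<pi> x) = isotropy x" if "x \<in> topspace X" for x
  proof -
    have "\<exists>y. y \<in> topspace X \<and> \<pi> y = \<pi> x" using that by blast
    from someI_ex[OF this] show ?thesis unfolding f_def using isotropy_cong that by blast
  qed
  have "f constant_on rel_interior F"
  proof (rule locally_constant_imp_constant)
    show "connected (rel_interior F)"
      using cF convex_rel_interior convex_connected by blast
    fix p assume p: "p \<in> rel_interior F"
    then obtain x where x: "x \<in> topspace X" "\<pi> x = p" using FP pi_surj by blast
    obtain c \<psi> where c: "standard_chart X A \<rho> c \<psi>" "x \<in> fst c"
      using standard x(1) by (auto simp: locally_standard_def)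
    have "card {i. snd c x $ i = 0} = 1"
      using standard_chart_facts(6)[OF c] card_facets_rel_interior[OF F] p x(2) by simp
    then obtain k where k: "{i. snd c x $ i = 0} = {k}" by (auto simp: card_1_singleton_iff)
    let ?U = "{z \<in> fst c. \<forall>l. snd c x $ l \<noteq> 0 \<longrightarrow> snd c z $ l \<noteq> 0}"
    have "openin (top_of_set P) (\<pi> ` ?U)"
      using pi_open openin_nonzero_coordinates standard_chart_facts(1)[OF c(1)] by blast
    then obtain V where V: "open V" "\<pi> ` ?U = P \<inter> V" by (auto simp: openin_open)
    have "p \<in> V" using V(2) x(2) c(2) by blast
    moreover have "f q = f p" if q: "q \<in> rel_interior F" "q \<in> V" for q
    proof -
      have "q \<in> \<pi> ` ?U" using q FP V by blast
      then obtain z where z: "z \<in> ?U" "\<pi> z = q" by blast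
      have "isotropy z = coordinate_circle \<psi> k" "isotropy x = coordinate_circle \<psi> k"
        using single_zero_chart[OF c(1) _ F, of z k] single_zero_chart[OF c F, of k] z q k p x by blast+
      then show ?thesis using f[of z] f[of x] x z c standard_chart_facts(3)[OF c(1)] by auto
    qed
    ultimately show "\<exists>T. openin (top_of_set (rel_interior F)) T \<and> p \<in> T \<and> (\<forall>q\<in>T. f q = f p)"
      using openin_open_Int[OF V(1), of "rel_interior F"] p by blast
  qed
  then obtain H where "\<And>p. p \<in> rel_interior F \<Longrightarrow> f p = H" by (auto simp: constant_on_def)
  then show ?thesis using f by metis
qed

text \<open>The circle \<open>T\<^sub>F\<close>. It is read off over the relative interior because
  isotropy groups grow over smaller faces.\<close>

definition facet_isotropy :: "'p set \<Rightarrow> (complex^'n) set" where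
  "facet_isotropy F = (SOME H. \<forall>x\<in>topspace X. \<pi> x \<in> rel_interior F \<longrightarrow> isotropy x = H)"

lemma facet_isotropy:
  "F facet_of P \<Longrightarrow> x \<in> topspace X \<Longrightarrow> \<pi> x \<in> rel_interior F \<Longrightarrow> isotropy x = facet_isotropy F"
  using someI_ex[OF facet_isotropy_exists[of F]] unfolding facet_isotropy_def by blast

text \<open>Perturb \<open>x\<close> so that only the \<open>k\<close>-th coordinate vanishes.  By the count of vanishing coordinates
  the perturbed point lies over a single facet \<open>G\<close>; nearby there is a point over the relative interior
  of \<open>G\<close>, again with only the \<open>k\<close>-th coordinate vanishing.\<close>

lemma zero_coordinate_facet:
  assumes c: "standard_chart X A \<rho> c \<psi>" and x: "x \<in> fst c" and k: "snd c x $ k = 0"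
  shows "\<exists>G. G facet_of P \<and> \<pi> x \<in> G \<and> facet_isotropy G = coordinate_circle \<psi> k"
proof -
  note cf = standard_chart_facts[OF c]
  \<comment> \<open>Every facet through a point outside \<open>?far\<close> also contains
    \<open>\<pi> x\<close>. As a finite union of facets \<open>?far\<close> is closed, so points
    near \<open>x\<close> lie over its complement.\<close>
  let ?far = "\<Union>{G. G facet_of P \<and> \<pi> x \<notin> G}"
  have facet_closed: "closed G" if "G facet_of P" for G
    using face_of_polytope_polytope[OF polytope facet_of_imp_face_of[OF that]]
    by (rule polytope_imp_closed)
  have "closed ?far"
    using finite_facets[of "\<lambda>G. \<pi> x \<notin> G"] facet_closed by (intro closed_Union) auto
  then have "openin X (topspace X - {z \<in> topspace X. \<pi> z \<in> ?far})"
    using closedin_pi_vimage by blast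
  moreover have "topspace X - {z \<in> topspace X. \<pi> z \<in> ?far} = {z \<in> topspace X. \<pi> z \<notin> ?far}" by blast
  ultimately have "openin X {z \<in> topspace X. \<pi> z \<notin> ?far}" by simp
  from open_chart_image[OF cf(1) this]
  have op: "open (snd c ` (fst c \<inter> {z \<in> topspace X. \<pi> z \<notin> ?far}))" (is "open ?O") .
  \<comment> \<open>For \<open>e > 0\<close> only the \<open>k\<close>-th coordinate vanishes; as
    \<open>e\<close> tends to \<open>0\<close> from the right, the vector converges to the
    coordinates of \<open>x\<close>.\<close>
  define u where "u e = (\<chi> l. if snd c x $ l = 0 \<and> l \<noteq> k then complex_of_real e else snd c x $ l)" for e
  have "(u \<longlongrightarrow> u 0) (at_right 0)"
    unfolding u_def by (intro tendsto_vec_lambda) (auto intro!: tendsto_eq_intros)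
  moreover have "u 0 = snd c x" by (auto simp: u_def vec_eq_iff)
  moreover have "snd c x \<in> ?O" using x cf(3) by blast
  ultimately have "\<forall>\<^sub>F e in at_right 0. u e \<in> ?O"
    by (intro topological_tendstoD[OF _ op]) simp_all
  moreover have "\<forall>\<^sub>F e::real in at_right 0. e > 0" by (simp add: eventually_at_right_less)
  ultimately have "\<forall>\<^sub>F e in at_right 0. u e \<in> ?O \<and> e > 0" by eventually_elim simp
  then obtain e where e: "u e \<in> ?O" "e > 0"
    using eventually_happens'[OF trivial_limit_at_right_real] by blast
  then obtain z where z: "z \<in> fst c" "\<pi> z \<notin> ?far" "snd c z = u e" by auto
  have Z: "{i. snd c z $ i = 0} = {k}" using z(3) e(2) k by (auto simp: u_def)
  then have "card {G. G facet_of P \<and> \<pi> z \<in> G} = 1" using cf(6)[OF z(1)] by simp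
  then obtain G where G: "G facet_of P" "\<pi> z \<in> G" by (auto simp: card_1_singleton_iff)
  then have "\<pi> x \<in> G" using z(2) by blast
  obtain w where w: "w \<in> {w \<in> fst c. \<forall>l. snd c z $ l \<noteq> 0 \<longrightarrow> snd c w $ l \<noteq> 0}" "\<pi> w \<in> rel_interior G"
    using near_facet_interior[OF openin_nonzero_coordinates[OF cf(1), of z] _ G] z(1) by blast
  have "isotropy w = coordinate_circle \<psi> k"
    using single_zero_chart[OF c _ G(1) w(2), of k] w(1) Z by blast
  then have "facet_isotropy G = coordinate_circle \<psi> k"
    using facet_isotropy[OF G(1) _ w(2)] w(1) cf(3) by auto
  then show ?thesis using G \<open>\<pi> x \<in> G\<close> by blast
qed

text \<open>By \<open>zero_coordinate_facet\<close> vanishing coordinates are sent to facets through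
  \<open>\<pi> x\<close>. Different coordinates have different circles, so this is injective; both
  sets have the same size, so every facet is reached.\<close>

lemma facet_zero_coordinate:
  assumes c: "standard_chart X A \<rho> c \<psi>" and x: "x \<in> fst c" and F: "F facet_of P" "\<pi> x \<in> F"
  shows "\<exists>k. snd c x $ k = 0 \<and> facet_isotropy F = coordinate_circle \<psi> k"
proof -
  let ?Z = "{i. snd c x $ i = 0}" and ?S = "{F. F facet_of P \<and> \<pi> x \<in> F}"
  have "\<forall>k\<in>?Z. \<exists>G. G \<in> ?S \<and> facet_isotropy G = coordinate_circle \<psi> k"
    using zero_coordinate_facet[OF c x] by simp
  from bchoice[OF this] obtain g
    where g: "\<And>k. k \<in> ?Z \<Longrightarrow> g k \<in> ?S \<and> facet_isotropy (g k) = coordinate_circle \<psi> k" by blast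
  have "inj_on g ?Z"
  proof (rule inj_onI)
    fix k l assume "k \<in> ?Z" "l \<in> ?Z" "g k = g l"
    then have "coordinate_circle \<psi> k = coordinate_circle \<psi> l" using g[of k] g[of l] by simp
    then show "k = l" by (rule inj_coordinate_circle[OF standard_chart_facts(2)[OF c]])
  qed
  then have "card (g ` ?Z) = card ?S"
    using standard_chart_facts(6)[OF c x] by (simp add: card_image)
  moreover have "g ` ?Z \<subseteq> ?S" using g by blast
  ultimately have "g ` ?Z = ?S"
    by (intro card_subset_eq[OF finite_facets])
  moreover have "F \<in> ?S" using F by simp
  ultimately obtain k where "k \<in> ?Z" "F = g k" by (metis (no_types, lifting) imageE)
  then show ?thesis using g[of k] by auto
qed

text \<open>Facets through a common point are sent to vanishing coordinates of a chart there. Each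
  such coordinate comes from a facet and the two finite sets have equal size, so the assignment is
  injective. Disjoint facets may well share their circle.\<close>

lemma facet_isotropy_inj:
  assumes F: "F facet_of P" "F' facet_of P" "F \<inter> F' \<noteq> {}"
    and eq: "facet_isotropy F = facet_isotropy F'"
  shows "F = F'"
proof -
  obtain p where p: "p \<in> F" "p \<in> F'" using F by blast
  then have "p \<in> P" using F facet_of_imp_subset by blast
  then obtain x where x: "x \<in> topspace X" "\<pi> x = p" using pi_surj by blast
  obtain c \<psi> where c: "standard_chart X A \<rho> c \<psi>" "x \<in> fst c"
    using standard x(1) by (auto simp: locally_standard_def)
  let ?Z = "{i. snd c x $ i = 0}" and ?S = "{F. F facet_of P \<and> \<pi> x \<in> F}"
  have "\<forall>G\<in>?S. \<exists>k. k \<in> ?Z \<and> facet_isotropy G = coordinate_circle \<psi> k"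
    using facet_zero_coordinate[OF c] by simp
  from bchoice[OF this] obtain k
    where k: "\<And>G. G \<in> ?S \<Longrightarrow> k G \<in> ?Z \<and> facet_isotropy G = coordinate_circle \<psi> (k G)" by blast
  note circ = inj_coordinate_circle[OF standard_chart_facts(2)[OF c(1)]]
  have "?Z \<subseteq> k ` ?S"
  proof
    fix i assume "i \<in> ?Z"
    then obtain G where G: "G \<in> ?S" "facet_isotropy G = coordinate_circle \<psi> i"
      using zero_coordinate_facet[OF c] by blast
    then have "k G = i" using k[OF G(1)] circ[of "k G" i] by simp
    then show "i \<in> k ` ?S" using G by blast
  qed
  then have "card ?S \<le> card (k ` ?S)"
    using standard_chart_facts(6)[OF c] card_mono[of "k ` ?S" ?Z] finite_facets[of "\<lambda>F. \<pi> x \<in> F"]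
    by simp
  then have inj: "inj_on k ?S"
    using finite_facets[of "\<lambda>F. \<pi> x \<in> F"] card_image_le[of ?S k]
    by (intro eq_card_imp_inj_on) auto
  have "F \<in> ?S" "F' \<in> ?S" using F p x by auto
  moreover from this have "k F = k F'"
    using k[of F] k[of F'] eq circ[of "k F" "k F'"] by simp
  ultimately show ?thesis using inj by (auto dest: inj_onD)
qed

text \<open>An involution would not do: its \<open>-1\<close>-eigenspace could be split between two summands, while the
  kernel of \<open>t\<^sup>2 + 1\<close> is even-dimensional in each of them.  Only \<open>\<psi> t $ k\<close> up to sign is independent of the
  chart, hence the condition on its square.\<close>

definition quarter_turn :: "'p set \<Rightarrow> complex^'n \<Rightarrow> bool" where
  "quarter_turn F t \<longleftrightarrow> t \<in> torus \<and> (\<forall>\<psi> k. torus_automorphism \<psi> \<and>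
     facet_isotropy F = coordinate_circle \<psi> k \<longrightarrow>
       \<psi> t $ k * \<psi> t $ k = - 1 \<and> (\<forall>l. l \<noteq> k \<longrightarrow> \<psi> t $ l = 1))"

text \<open>The element is found in one chart, with \<open>k\<close>-th coordinate
  \<open>\<i>\<close>. Its order four does not depend on the automorphism: for any other
  \<open>\<psi>'\<close> with the same circle the remaining coordinate has fourth power
  \<open>1\<close> but square different from \<open>1\<close>.\<close>

lemma quarter_turn_exists:
  assumes F: "F facet_of P"
  shows "\<exists>t. quarter_turn F t"
proof -
  obtain p where "p \<in> F" using F by (auto simp: facet_of_def)
  moreover from this have "p \<in> P" using F facet_of_imp_subset by blast
  then obtain x where x: "x \<in> topspace X" "\<pi> x = p" using pi_surj by blast
  moreover obtain c \<psi> where c: "standard_chart X A \<rho> c \<psi>" "x \<in> fst c"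
    using standard x(1) by (auto simp: locally_standard_def)
  ultimately obtain k where k: "facet_isotropy F = coordinate_circle \<psi> k"
    using facet_zero_coordinate[OF c F] by blast
  note \<psi> = standard_chart_facts(2)[OF c(1)]
  obtain t where t: "t \<in> coordinate_circle \<psi> k" "\<psi> t $ k = \<i>"
    by (rule torus_automorphism_coordinate[OF \<psi>, of \<i>]) auto
  have tt: "t \<in> torus" using t by (simp add: coordinate_circle_def)
  have hom: "\<psi>' (s * s') = \<psi>' s * \<psi>' s'" if "torus_automorphism \<psi>'" "s \<in> torus" "s' \<in> torus" for \<psi>' s s'
    using that by (simp add: torus_automorphism_def)
  have inj: "s = s'" if "torus_automorphism \<psi>'" "s \<in> torus" "s' \<in> torus" "\<psi>' s = \<psi>' s'" for \<psi>' s s'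
    using that by (auto simp: torus_automorphism_def bij_betw_def dest: inj_onD)
  have t2: "t * t \<in> torus" using tt torus_mult by blast
  have t4: "t * t * (t * t) \<in> torus" using t2 torus_mult by blast
  have sq: "\<psi> (t * t) $ k = - 1" using hom[OF \<psi> tt tt] t(2) by simp
  then have ne1: "t * t \<noteq> 1" using torus_automorphism_one[OF \<psi>] by auto
  have "\<psi> (t * t * (t * t)) = \<psi> 1"
    unfolding torus_automorphism_one[OF \<psi>] vec_eq_iff
  proof
    fix i show "\<psi> (t * t * (t * t)) $ i = 1 $ i"
      using t by (cases "i = k") (auto simp: hom[OF \<psi> t2 t2] hom[OF \<psi> tt tt] coordinate_circle_def)
  qed
  then have one: "t * t * (t * t) = 1" using inj[OF \<psi> t4 one_in_torus] by blast
  have "\<psi>' t $ k' * \<psi>' t $ k' = - 1 \<and> (\<forall>l. l \<noteq> k' \<longrightarrow> \<psi>' t $ l = 1)"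
    if \<psi>': "torus_automorphism \<psi>'" and k': "facet_isotropy F = coordinate_circle \<psi>' k'" for \<psi>' k'
  proof -
    have l: "\<psi>' t $ l = 1" if "l \<noteq> k'" for l
      using t(1) that k k' by (auto simp: coordinate_circle_def)
    let ?w = "\<psi>' t $ k'"
    have "?w * ?w \<noteq> 1"
    proof
      assume "?w * ?w = 1"
      then have "\<psi>' (t * t) = \<psi>' 1"
        unfolding torus_automorphism_one[OF \<psi>'] vec_eq_iff hom[OF \<psi>' tt tt]
        using l by (metis mult_1 one_index vector_mult_component)
      then show False using inj[OF \<psi>' t2 one_in_torus] ne1 by blast
    qed
    moreover have "(?w * ?w) * (?w * ?w) = 1"
      using arg_cong[OF one, of "\<lambda>s. \<psi>' s $ k'"]
      by (simp add: hom[OF \<psi>' t2 t2] hom[OF \<psi>' tt tt] torus_automorphism_one[OF \<psi>'])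
    ultimately have "?w * ?w = - 1" by (metis square_eq_1_iff)
    then show ?thesis using l by blast
  qed
  then show ?thesis using tt unfolding quarter_turn_def by blast
qed

text \<open>The point \<open>x\<close> is fixed because the only coordinate in which
  \<open>\<psi> t\<close> differs from \<open>1\<close> vanishes at \<open>x\<close>.\<close>

lemma quarter_turn_chart:
  assumes t: "quarter_turn F t" and F: "F facet_of P" "\<pi> x \<in> F"
    and c: "standard_chart X A \<rho> c \<psi>" and x: "x \<in> fst c"
  obtains k where "facet_isotropy F = coordinate_circle \<psi> k" "\<psi> t $ k * \<psi> t $ k = - 1"
    "\<And>l. l \<noteq> k \<Longrightarrow> \<psi> t $ l = 1" "\<rho> t x = x"
proof -
  obtain k where k: "snd c x $ k = 0" "facet_isotropy F = coordinate_circle \<psi> k"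
    using facet_zero_coordinate[OF c x F] by blast
  then have kt: "\<psi> t $ k * \<psi> t $ k = - 1" "\<And>l. l \<noteq> k \<Longrightarrow> \<psi> t $ l = 1" and tt: "t \<in> torus"
    using t standard_chart_facts(2)[OF c] unfolding quarter_turn_def by blast+
  have "\<psi> t $ l = 1" if "snd c x $ l \<noteq> 0" for l
  proof -
    have "l \<noteq> k" using k(1) that by blast
    then show ?thesis by (rule kt(2))
  qed
  then have "t \<in> isotropy x" unfolding isotropy_chart[OF c x] using tt by blast
  then show ?thesis using that k(2) kt by (simp add: isotropy_def)
qed

text \<open>An invariant set is the full preimage of its image, so the quotient map carries
  closedness to \<open>P\<close>, and \<open>P\<close> itself is closed.\<close>

lemma invariant_closed_image:
  assumes S: "closedin X S" and inv: "\<And>x t. x \<in> S \<Longrightarrow> t \<in> torus \<Longrightarrow> \<rho> t x \<in> S"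
  shows "closed (\<pi> ` S)"
proof -
  have SX: "S \<subseteq> topspace X" using S closedin_subset by blast
  have pre: "{x \<in> topspace X. \<pi> x \<in> \<pi> ` S} = S"
  proof
    show "{x \<in> topspace X. \<pi> x \<in> \<pi> ` S} \<subseteq> S"
    proof
      fix x assume "x \<in> {x \<in> topspace X. \<pi> x \<in> \<pi> ` S}"
      then obtain y where y: "x \<in> topspace X" "y \<in> S" "\<pi> y = \<pi> x" by auto
      then have "\<exists>t\<in>torus. x = \<rho> t y" using pi_eq_iff[of y x] SX by blast
      then show "x \<in> S" using inv y by blast
    qed
  qed (use SX in blast)
  have "\<pi> ` S \<subseteq> P" using SX pi_surj by blast
  then have "closedin X {x \<in> topspace X. \<pi> x \<in> \<pi> ` S} \<longleftrightarrow> closedin (top_of_set P) (\<pi> ` S)"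
    using proj unfolding orbit_projection_def quotient_map_closedin topspace_euclidean_subtopology by blast
  then have "closedin (top_of_set P) (\<pi> ` S)"
    using S unfolding pre by blast
  then show ?thesis
    using polytope_imp_closed[OF polytope] closedin_closed_trans by blast
qed

end

section \<open>Stable splittings\<close>

lemma equivariant_bundle_iso_fibre:
  assumes "equivariant_bundle_iso B C f"
  shows "bij_betw f (fibre B x) (fibre C x)"
proof -
  have hom: "homeomorphic_map (total B) (total C) f"
    and pr: "\<And>u. u \<in> topspace (total B) \<Longrightarrow> proj C (f u) = proj B u"
    using assms by (auto simp: equivariant_bundle_iso_def)
  have "inj_on f (fibre B x)"
    using homeomorphic_imp_injective_map[OF hom] by (rule inj_on_subset) (auto simp: fibre_def)
  moreover have "f ` fibre B x = fibre C x"
    using homeomorphic_imp_surjective_map[OF hom] pr unfolding fibre_def by force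
  ultimately show ?thesis by (simp add: bij_betw_def)
qed

lemma equivariant_bundle_iso_linear:
  assumes "equivariant_bundle_iso B C f" "u \<in> fibre B x"
  shows "v \<in> fibre B x \<Longrightarrow> f (vadd B u v) = vadd C (f u) (f v)"
    and "f (vscale B s u) = vscale C s (f u)"
    and "t \<in> torus \<Longrightarrow> f (gact B t u) = gact C t (f u)"
  using assms by (auto simp: equivariant_bundle_iso_def fibre_def)

text \<open>Bundles have no constant for zero, so the zero vector is described by its invariance
  under scalars and under the isotropy group of \<open>x\<close>. The latter holds because the
  action is linear and \<open>vscale B 0 e\<close> is the same for all \<open>e\<close> in the
  fibre.\<close>

lemma zero_vector_fibre:
  assumes B: "equivariant_vector_bundle X \<rho> k B" and x: "x \<in> topspace X"
  obtains z where "z \<in> fibre B x" "\<And>s. vscale B s z = z"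
    "\<And>t. t \<in> torus \<Longrightarrow> \<rho> t x = x \<Longrightarrow> gact B t z = z"
proof -
  obtain U h where U: "x \<in> U" and h: "local_trivialisation X k B U h"
    using B x unfolding equivariant_vector_bundle_def by blast
  have "(\<lambda>i. 0) \<in> topspace (Euclidean_space k)" by (simp add: topspace_Euclidean_space)
  then obtain e where e: "e \<in> fibre B x"
    using local_trivialisation_fibre[OF h U x] by (auto simp: bij_betw_def)
  have "gact B t (vscale B 0 e) = vscale B 0 e" if "t \<in> torus" "\<rho> t x = x" for t
    using gact_linear(2)[OF B that(1) e, of 0] gact_fibre[OF B that(1) e] vscale_fibre(4)[OF B x e]
    by (metis that(2))
  then show ?thesis
    using that[of "vscale B 0 e"] vscale_fibre(1,3)[OF B x e] by simp
qed

text \<open>As the torus is commutative, the action of \<open>t\<close> over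
  \<open>\<rho> s x\<close> is conjugate by \<open>s\<close> to its action over \<open>x\<close>,
  and conjugation by a linear map preserves scalars.\<close>

lemma scalar_action_orbit:
  assumes B: "equivariant_vector_bundle X \<rho> k B" and act: "continuous_torus_action X \<rho>"
    and x: "x \<in> topspace X" and s: "s \<in> torus" and t: "t \<in> torus"
    and e: "\<forall>e\<in>fibre B x. gact B t e = vscale B \<sigma> e"
  shows "\<forall>e\<in>fibre B (\<rho> s x). gact B t e = vscale B \<sigma> e"
proof
  fix e assume e': "e \<in> fibre B (\<rho> s x)"
  define s' where "s' = (\<chi> i. inverse (s $ i))"
  have s': "s' \<in> torus" using s by (simp add: s'_def torus_def norm_inverse)
  have "s $ i \<noteq> 0" for i using s by (auto simp: torus_def dest: spec[of _ i])
  then have inv: "s' * s = 1" "s * s' = 1" by (auto simp: s'_def vec_eq_iff)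
  have "\<rho> s' (\<rho> s x) = x"
    using act s s' x inv(1) unfolding continuous_torus_action_def by metis
  then have e1: "gact B s' e \<in> fibre B x" using gact_fibre[OF B s' e'] by simp
  have one: "gact B 1 e = e"
    using B e' by (auto simp: fibre_def equivariant_vector_bundle_def continuous_torus_action_def)
  have e2: "gact B s (gact B s' e) = e"
    using gact_mult[OF B s s' e'] inv(2) one by simp
  have "gact B t e = gact B s (gact B t (gact B s' e))"
    using gact_mult[OF B s t e1] gact_mult[OF B t s e1] e2 by (simp add: mult.commute)
  also have "\<dots> = gact B s (vscale B \<sigma> (gact B s' e))" using e e1 by simp
  also have "\<dots> = vscale B \<sigma> e" using gact_linear(2)[OF B s e1] e2 by simp
  finally show "gact B t e = vscale B \<sigma> e" .
qed

lemma bij_betw_stable_tangent_fibre: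
  assumes M: "smooth_manifold X A" and c: "smooth_chart X A c" and y: "y \<in> fst c" "y \<in> topspace X"
  shows "bij_betw (\<lambda>(u, \<alpha>). (tangent_vector A c y u, \<alpha>, y)) (UNIV \<times> topspace (Euclidean_space a))
    (fibre (whitney_sum (tangent_bundle X A \<rho>) (trivial_bundle X \<rho> a)) y)"
proof -
  let ?v = "tangent_vector A c y" and ?E = "topspace (Euclidean_space a)"
  have inj: "inj ?v" and fib: "fibre (tangent_bundle X A \<rho>) y = range ?v"
    using tangent_vector_fibre[OF M c y(1), of \<rho>] by (auto simp: bij_betw_def)
  have "inj_on (\<lambda>(u, \<alpha>). (?v u, \<alpha>, y)) (UNIV \<times> ?E)"
    using injD[OF inj] by (auto intro!: inj_onI)
  moreover have "(\<lambda>(u, \<alpha>). (?v u, \<alpha>, y)) ` (UNIV \<times> ?E) = range ?v \<times> (?E \<times> {y})"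
  proof (intro equalityI subsetI)
    fix p assume "p \<in> range ?v \<times> (?E \<times> {y})"
    then obtain u \<alpha> where "p = (?v u, \<alpha>, y)" "\<alpha> \<in> ?E" by blast
    then show "p \<in> (\<lambda>(u, \<alpha>). (?v u, \<alpha>, y)) ` (UNIV \<times> ?E)"
      by (auto intro!: image_eqI[of _ _ "(u, \<alpha>)"])
  qed auto
  ultimately show ?thesis
    unfolding fibre_whitney_sum fibre_trivial_bundle[OF y(2)] fib by (simp only: bij_betw_def)
qed

section \<open>A fixed stable splitting of the tangent bundle\<close>

locale stable_splitting = orbit_space X A \<rho> P \<pi>
  for X :: "'m topology" and A :: "('m, complex^'n) chart set"
    and \<rho> :: "complex^'n \<Rightarrow> 'm \<Rightarrow> 'm" and P :: "'p::euclidean_space set" and \<pi> :: "'m \<Rightarrow> 'p" +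
  fixes r :: nat and \<xi> :: "nat \<Rightarrow> ('m, complex^'n, 'v) equivariant_bundle" and a b :: nat
    and f :: "('m \<times> (('m, complex^'n) chart \<Rightarrow> complex^'n)) \<times> (nat \<Rightarrow> real) \<times> 'm \<Rightarrow>
      (nat \<Rightarrow> 'v) \<times> (nat \<Rightarrow> real) \<times> 'm"
  assumes manifold: "smooth_manifold X A" and r: "r \<ge> 1"
    and plane: "\<And>j. j \<in> {1..r} \<Longrightarrow> equivariant_vector_bundle X \<rho> 2 (\<xi> j)"
    and iso: "equivariant_bundle_iso (whitney_sum (tangent_bundle X A \<rho>) (trivial_bundle X \<rho> a))
      (whitney_sum (whitney_sum_family r \<xi>) (trivial_bundle X \<rho> b)) f"
begin

abbreviation B where "B \<equiv> whitney_sum (tangent_bundle X A \<rho>) (trivial_bundle X \<rho> a)"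
abbreviation C where "C \<equiv> whitney_sum (whitney_sum_family r \<xi>) (trivial_bundle X \<rho> b)"

lemma operations_C:
  "vadd C (w, \<beta>, x) (w', \<beta>', x') = ((\<lambda>j\<in>{1..r}. vadd (\<xi> j) (w j) (w' j)), (\<lambda>i. \<beta> i + \<beta>' i), x)"
  "vscale C s (w, \<beta>, x) = ((\<lambda>j\<in>{1..r}. vscale (\<xi> j) s (w j)), (\<lambda>i. s * \<beta> i), x)"
  "gact C t (w, \<beta>, x) = ((\<lambda>j\<in>{1..r}. gact (\<xi> j) t (w j)), \<beta>, \<rho> t x)"
  by (simp_all add: whitney_sum_def whitney_sum_family_def trivial_bundle_def)

lemma fibre_C:
  "x \<in> topspace X \<Longrightarrow>
    fibre C x = (\<Pi>\<^sub>E j\<in>{1..r}. fibre (\<xi> j) x) \<times> (topspace (Euclidean_space b) \<times> {x})"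
  by (simp only: fibre_whitney_sum fibre_whitney_sum_family[OF r] fibre_trivial_bundle)

lemma operations_B:
  assumes c: "standard_chart X A \<rho> c \<psi>" "y \<in> fst c"
  shows "vadd B (tangent_vector A c y u, \<alpha>, y) (tangent_vector A c y v, \<beta>, y) =
      (tangent_vector A c y (u + v), (\<lambda>i. \<alpha> i + \<beta> i), y)"
    and "vscale B s (tangent_vector A c y u, \<alpha>, y) =
      (tangent_vector A c y (s *\<^sub>R u), (\<lambda>i. s * \<alpha> i), y)"
    and "t \<in> torus \<Longrightarrow> \<rho> t y = y \<Longrightarrow> gact B t (tangent_vector A c y u, \<alpha>, y) =
      (tangent_vector A c y (\<psi> t * u), \<alpha>, y)"
proof -
  have "smooth_chart X A c" using c by (simp add: standard_chart_def)
  note * = tangent_vector_vadd[OF this c(2)] tangent_vector_vscale[OF this c(2)]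
    tangent_vector_gact[OF manifold c]
  show "vadd B (tangent_vector A c y u, \<alpha>, y) (tangent_vector A c y v, \<beta>, y) =
      (tangent_vector A c y (u + v), (\<lambda>i. \<alpha> i + \<beta> i), y)"
    "vscale B s (tangent_vector A c y u, \<alpha>, y) =
      (tangent_vector A c y (s *\<^sub>R u), (\<lambda>i. s * \<alpha> i), y)"
    "t \<in> torus \<Longrightarrow> \<rho> t y = y \<Longrightarrow> gact B t (tangent_vector A c y u, \<alpha>, y) =
      (tangent_vector A c y (\<psi> t * u), \<alpha>, y)"
    unfolding whitney_sum_def trivial_bundle_def by (simp_all add: *)
qed

lemma fibre_B:
  assumes c: "standard_chart X A \<rho> c \<psi>" "y \<in> fst c"
  shows "p \<in> fibre B y \<longleftrightarrow> (\<exists>u. \<exists>\<alpha>\<in>topspace (Euclidean_space a). p = (tangent_vector A c y u, \<alpha>, y))"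
    and "\<lbrakk>\<alpha> \<in> topspace (Euclidean_space a); \<beta> \<in> topspace (Euclidean_space a)\<rbrakk> \<Longrightarrow>
      (tangent_vector A c y u, \<alpha>, y) = (tangent_vector A c y v, \<beta>, y) \<longleftrightarrow> u = v \<and> \<alpha> = \<beta>"
proof -
  have "smooth_chart X A c" "y \<in> topspace X"
    using c standard_chart_facts(3)[OF c(1)] by (auto simp: standard_chart_def)
  note bij = bij_betw_stable_tangent_fibre[OF manifold this(1) c(2) this(2), of a \<rho>]
  show "p \<in> fibre B y \<longleftrightarrow> (\<exists>u. \<exists>\<alpha>\<in>topspace (Euclidean_space a). p = (tangent_vector A c y u, \<alpha>, y))"
    unfolding bij_betw_imp_surj_on[OF bij, symmetric] by (auto simp: image_iff)
  show "\<lbrakk>\<alpha> \<in> topspace (Euclidean_space a); \<beta> \<in> topspace (Euclidean_space a)\<rbrakk> \<Longrightarrow>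
      (tangent_vector A c y u, \<alpha>, y) = (tangent_vector A c y v, \<beta>, y) \<longleftrightarrow> u = v \<and> \<alpha> = \<beta>"
    using inj_onD[OF bij_betw_imp_inj_on[OF bij], of "(u, \<alpha>)" "(v, \<beta>)"] by auto
qed

lemma gact_fibre_B:
  assumes c: "standard_chart X A \<rho> c \<psi>" "y \<in> fst c" and t: "t \<in> torus" "\<rho> t y = y"
    and p: "p \<in> fibre B y"
  shows "gact B t p \<in> fibre B y"
  using p operations_B(3)[OF c t] unfolding fibre_B(1)[OF c] by auto

text \<open>The inclusion of the \<open>j\<close>-th summand. The other entries are zero vectors, of
  which only the invariance properties are passed on.\<close>

lemma embed_summand:
  assumes x: "x \<in> topspace X" and j: "j \<in> {1..r}" and e: "e \<in> fibre (\<xi> j) x"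
  obtains w where "(w, (\<lambda>i. 0), x) \<in> fibre C x" "w j = e"
    "\<And>l s. l \<in> {1..r} \<Longrightarrow> l \<noteq> j \<Longrightarrow> vscale (\<xi> l) s (w l) = w l"
    "\<And>l t. l \<in> {1..r} \<Longrightarrow> l \<noteq> j \<Longrightarrow> t \<in> torus \<Longrightarrow> \<rho> t x = x \<Longrightarrow> gact (\<xi> l) t (w l) = w l"
proof -
  have "\<forall>l\<in>{1..r}. \<exists>z. z \<in> fibre (\<xi> l) x \<and> (\<forall>s. vscale (\<xi> l) s z = z) \<and>
      (\<forall>t\<in>torus. \<rho> t x = x \<longrightarrow> gact (\<xi> l) t z = z)"
    using zero_vector_fibre[OF plane x] by metis
  from bchoice[OF this] obtain z where z: "\<And>l. l \<in> {1..r} \<Longrightarrow> z l \<in> fibre (\<xi> l) x \<and>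
      (\<forall>s. vscale (\<xi> l) s (z l) = z l) \<and> (\<forall>t\<in>torus. \<rho> t x = x \<longrightarrow> gact (\<xi> l) t (z l) = z l)"
    by blast
  define w where "w = (\<lambda>l\<in>{1..r}. if l = j then e else z l)"
  have "(w, (\<lambda>i. 0), x) \<in> fibre C x"
    unfolding fibre_C[OF x] using z e by (auto simp: w_def topspace_Euclidean_space)
  then show ?thesis
    by (rule that) (use z j in \<open>auto simp: w_def\<close>)
qed

text \<open>This is \<open>t^3 + t = t^2 + 1\<close>, that is \<open>(t - 1)(t^2 + 1) = 0\<close>
  written without subtraction. On the stable tangent fibre it holds in each coordinate, where
  \<open>\<psi> t\<close> is a square root of \<open>-1\<close> or is \<open>1\<close>, and on the
  trivial summand. The isomorphism \<open>f\<close> carries it to the sum, whose \<open>j\<close>-th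
  component is read off.\<close>

lemma summand_identity:
  assumes c: "standard_chart X A \<rho> c \<psi>" "x \<in> fst c" and t: "t \<in> torus" "\<rho> t x = x"
    and k: "\<psi> t $ k * \<psi> t $ k = - 1" "\<And>l. l \<noteq> k \<Longrightarrow> \<psi> t $ l = 1"
    and j: "j \<in> {1..r}" and e: "e \<in> fibre (\<xi> j) x"
  shows "vadd (\<xi> j) (gact (\<xi> j) t (gact (\<xi> j) t (gact (\<xi> j) t e))) (gact (\<xi> j) t e) =
    vadd (\<xi> j) (gact (\<xi> j) t (gact (\<xi> j) t e)) e"
proof -
  have x: "x \<in> topspace X" using c standard_chart_facts(3)[OF c(1)] by blast
  obtain w where w: "(w, (\<lambda>i. 0), x) \<in> fibre C x" "w j = e"
    using embed_summand[OF x j e] by metis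
  obtain p where p: "p \<in> fibre B x" "f p = (w, (\<lambda>i. 0), x)"
    using equivariant_bundle_iso_fibre[OF iso, of x] w(1) by (metis (no_types, lifting) bij_betw_imp_surj_on imageE)
  obtain u \<alpha> where u: "p = (tangent_vector A c x u, \<alpha>, x)"
    using p(1) fibre_B(1)[OF c] by blast
  have G: "gact B t p \<in> fibre B x" "gact B t (gact B t p) \<in> fibre B x"
    "gact B t (gact B t (gact B t p)) \<in> fibre B x"
    using gact_fibre_B[OF c t] p(1) by blast+
  note lin = equivariant_bundle_iso_linear[OF iso]
  have "\<psi> t * (\<psi> t * (\<psi> t * u)) + \<psi> t * u = \<psi> t * (\<psi> t * u) + u"
    unfolding vec_eq_iff
  proof
    fix l
    have "\<psi> t $ k * (\<psi> t $ k * v) = - v" for v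
      using k(1) by (simp flip: mult.assoc)
    then show "(\<psi> t * (\<psi> t * (\<psi> t * u)) + \<psi> t * u) $ l = (\<psi> t * (\<psi> t * u) + u) $ l"
      using k(2) by (cases "l = k") auto
  qed
  then have "vadd B (gact B t (gact B t (gact B t p))) (gact B t p) = vadd B (gact B t (gact B t p)) p"
    by (simp add: u operations_B[OF c] t)
  then have "f (vadd B (gact B t (gact B t (gact B t p))) (gact B t p)) = f (vadd B (gact B t (gact B t p)) p)"
    by simp
  then have "vadd C (gact C t (gact C t (gact C t (f p)))) (gact C t (f p)) =
      vadd C (gact C t (gact C t (f p))) (f p)"
    by (simp add: lin(1)[OF G(3) G(1)] lin(1)[OF G(2) p(1)] lin(3)[OF p(1) t(1)]
        lin(3)[OF G(1) t(1)] lin(3)[OF G(2) t(1)])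
  from arg_cong[OF this, of "\<lambda>q. fst q j"] show ?thesis
    using j w(2) by (simp add: p(2) operations_C)
qed

text \<open>A nonzero vector of the \<open>j\<close>-th summand would correspond under
  \<open>f\<close> to a stable tangent vector \<open>(u, \<alpha>)\<close> on which both squares act
  as \<open>-1\<close>. The torus fixes \<open>\<alpha>\<close>, so \<open>\<alpha>\<close>
  vanishes; each coordinate of \<open>u\<close> is fixed by \<open>t\<close> or by
  \<open>t'\<close>, so it vanishes as well.\<close>

lemma no_common_half_turn:
  assumes c: "standard_chart X A \<rho> c \<psi>" "x \<in> fst c"
    and t: "t \<in> torus" "\<rho> t x = x" and t': "t' \<in> torus" "\<rho> t' x = x"
    and k: "\<And>l. l \<noteq> k \<Longrightarrow> \<psi> t $ l = 1" and k': "\<And>l. l \<noteq> k' \<Longrightarrow> \<psi> t' $ l = 1" and ne: "k \<noteq> k'"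
    and j: "j \<in> {1..r}"
  shows "\<not> ((\<forall>e\<in>fibre (\<xi> j) x. gact (\<xi> j) (t * t) e = vscale (\<xi> j) (-1) e) \<and>
    (\<forall>e\<in>fibre (\<xi> j) x. gact (\<xi> j) (t' * t') e = vscale (\<xi> j) (-1) e))"
proof
  assume half: "(\<forall>e\<in>fibre (\<xi> j) x. gact (\<xi> j) (t * t) e = vscale (\<xi> j) (-1) e) \<and>
    (\<forall>e\<in>fibre (\<xi> j) x. gact (\<xi> j) (t' * t') e = vscale (\<xi> j) (-1) e)"
  have x: "x \<in> topspace X" using c standard_chart_facts(3)[OF c(1)] by blast
  obtain e where e: "e \<in> fibre (\<xi> j) x" "vscale (\<xi> j) 0 e \<noteq> e"
    using plane_bundle_nonzero[OF plane[OF j] x] by metis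
  obtain w where w: "(w, (\<lambda>i. 0), x) \<in> fibre C x" "w j = e"
    and ws: "\<And>l s. l \<in> {1..r} \<Longrightarrow> l \<noteq> j \<Longrightarrow> vscale (\<xi> l) s (w l) = w l"
    and wg: "\<And>l t. l \<in> {1..r} \<Longrightarrow> l \<noteq> j \<Longrightarrow> t \<in> torus \<Longrightarrow> \<rho> t x = x \<Longrightarrow> gact (\<xi> l) t (w l) = w l"
    using embed_summand[OF x j e(1)] by metis
  obtain p where p: "p \<in> fibre B x" "f p = (w, (\<lambda>i. 0), x)"
    using equivariant_bundle_iso_fibre[OF iso, of x] w(1) by (metis (no_types, lifting) bij_betw_imp_surj_on imageE)
  obtain u \<alpha> where u: "p = (tangent_vector A c x u, \<alpha>, x)" "\<alpha> \<in> topspace (Euclidean_space a)"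
    using p(1) fibre_B(1)[OF c] by blast
  have aE: "(\<lambda>i. s * \<alpha> i) \<in> topspace (Euclidean_space a)" for s
    using u(2) by (auto simp: topspace_Euclidean_space)
  have sB: "vscale B s p \<in> fibre B x" for s
    using aE unfolding fibre_B(1)[OF c] u(1) operations_B(2)[OF c] by blast
  note lin = equivariant_bundle_iso_linear[OF iso]
  have inj: "inj_on f (fibre B x)"
    using equivariant_bundle_iso_fibre[OF iso, of x] by (rule bij_betw_imp_inj_on)
  have sq: "\<psi> s * (\<psi> s * u) = - u \<and> (\<forall>i. \<alpha> i = - \<alpha> i)" if s: "s \<in> torus" "\<rho> s x = x"
    and h: "\<forall>e\<in>fibre (\<xi> j) x. gact (\<xi> j) (s * s) e = vscale (\<xi> j) (-1) e" for s
  proof -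
    have G: "gact B s p \<in> fibre B x" "gact B s (gact B s p) \<in> fibre B x"
      using gact_fibre_B[OF c s] p(1) by blast+
    have "gact (\<xi> l) s (gact (\<xi> l) s (w l)) = vscale (\<xi> l) (-1) (w l)" if l: "l \<in> {1..r}" for l
    proof (cases "l = j")
      case True
      then show ?thesis using h e(1) w(2) gact_mult[OF plane[OF j] s(1) s(1) e(1)] by simp
    next
      case False
      then show ?thesis using ws wg l s by simp
    qed
    then have "gact C s (gact C s (f p)) = vscale C (-1) (f p)"
      by (simp add: p(2) operations_C s(2) restrict_def fun_eq_iff)
    then have "f (gact B s (gact B s p)) = f (vscale B (-1) p)"
      by (simp add: lin(2)[OF p(1)] lin(3)[OF p(1) s(1)] lin(3)[OF G(1) s(1)])
    then have "gact B s (gact B s p) = vscale B (-1) p"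
      using inj G(2) sB by (auto dest: inj_onD)
    then have "\<psi> s * (\<psi> s * u) = (-1) *\<^sub>R u \<and> \<alpha> = (\<lambda>i. -1 * \<alpha> i)"
      unfolding u(1) operations_B(2)[OF c] operations_B(3)[OF c s]
      using fibre_B(2)[OF c u(2) aE] by blast
    then show ?thesis by (simp add: fun_eq_iff)
  qed
  have 1: "\<psi> t * (\<psi> t * u) = - u" "\<forall>i. \<alpha> i = - \<alpha> i" and 2: "\<psi> t' * (\<psi> t' * u) = - u"
    using sq[OF t] sq[OF t'] half by blast+
  have "u $ l = 0" for l
  proof -
    obtain s where "\<psi> s * (\<psi> s * u) = - u" "\<psi> s $ l = 1" using 1(1) 2 k k' ne by metis
    then have "u $ l = - (u $ l)" by (metis mult_1 uminus_vec_def vec_lambda_beta vector_mult_component vector_uminus_component)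
    then show ?thesis by simp
  qed
  then have "u = 0" by (simp add: vec_eq_iff)
  moreover have "\<alpha> = (\<lambda>i. 0)" using 1(2) by (auto simp: fun_eq_iff)
  \<comment> \<open>Vanishing is transported as invariance under the scalar \<open>0\<close>, which
    \<open>f\<close> respects and which contradicts the choice of \<open>e\<close>.\<close>
  ultimately have "vscale B 0 p = p" unfolding u(1) operations_B(2)[OF c] by simp
  then have "vscale C 0 (f p) = f p" using lin(2)[OF p(1), of 0] by simp
  from arg_cong[OF this, of "\<lambda>q. fst q j"] have "vscale (\<xi> j) 0 e = e"
    using j w(2) by (simp add: p(2) operations_C)
  then show False using e(2) by blast
qed

text \<open>If \<open>t\<close> fixed all the summands, it would fix the whole fibre of
  \<open>C\<close>, hence by \<open>f\<close> that of \<open>B\<close>; but it moves the tangent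
  vector along the \<open>k\<close>-th axis.\<close>

lemma some_summand_moved:
  assumes c: "standard_chart X A \<rho> c \<psi>" "x \<in> fst c" and t: "t \<in> torus" "\<rho> t x = x"
    and k: "\<psi> t $ k \<noteq> 1"
  shows "\<exists>j\<in>{1..r}. \<exists>e\<in>fibre (\<xi> j) x. gact (\<xi> j) t e \<noteq> e"
proof (rule ccontr)
  assume "\<not> ?thesis"
  then have triv: "\<And>j e. j \<in> {1..r} \<Longrightarrow> e \<in> fibre (\<xi> j) x \<Longrightarrow> gact (\<xi> j) t e = e" by blast
  have x: "x \<in> topspace X" using c standard_chart_facts(3)[OF c(1)] by blast
  define p where "p = (tangent_vector A c x (axis k 1), (\<lambda>i :: nat. 0 :: real), x)"
  have E: "(\<lambda>i. 0) \<in> topspace (Euclidean_space a)" by (simp add: topspace_Euclidean_space)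
  have p: "p \<in> fibre B x" unfolding fibre_B(1)[OF c] p_def using E by blast
  have "f p \<in> fibre C x"
    using equivariant_bundle_iso_fibre[OF iso, of x] p by (auto simp: bij_betw_def)
  then obtain w \<beta> where w: "f p = (w, \<beta>, x)" "w \<in> (\<Pi>\<^sub>E j\<in>{1..r}. fibre (\<xi> j) x)"
    unfolding fibre_C[OF x] by blast
  have "(\<lambda>j\<in>{1..r}. gact (\<xi> j) t (w j)) = w"
    using w(2) triv by (auto simp: fun_eq_iff PiE_iff extensional_def)
  then have "gact C t (f p) = f p" by (simp add: w(1) operations_C t(2))
  then have "f (gact B t p) = f p"
    using equivariant_bundle_iso_linear(3)[OF iso p t(1)] by simp
  then have "gact B t p = p"
    using equivariant_bundle_iso_fibre[OF iso, of x] p gact_fibre_B[OF c t p]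
    by (auto simp: bij_betw_def dest: inj_onD)
  then have "\<psi> t * axis k 1 = axis k 1"
    unfolding p_def operations_B(3)[OF c t] using fibre_B(2)[OF c E E] by blast
  then have "(\<psi> t * axis k 1) $ k = axis k 1 $ k" by simp
  then show False using k by (simp add: axis_def)
qed

section \<open>Colors of the facets\<close>

lemma facet_dichotomy:
  assumes F: "F facet_of P" and t: "quarter_turn F t" and j: "j \<in> {1..r}"
  shows "(\<forall>x\<in>topspace X. \<pi> x \<in> F \<longrightarrow> (\<forall>e\<in>fibre (\<xi> j) x. gact (\<xi> j) t e = vscale (\<xi> j) 1 e)) \<or>
    (\<forall>x\<in>topspace X. \<pi> x \<in> F \<longrightarrow> (\<forall>e\<in>fibre (\<xi> j) x. gact (\<xi> j) (t * t) e = vscale (\<xi> j) (-1) e))"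
proof -
  note Bj = plane[OF j]
  define K where "K s \<sigma> = {x \<in> topspace X. \<rho> s x = x \<and>
    (\<forall>e\<in>fibre (\<xi> j) x. gact (\<xi> j) s e = vscale (\<xi> j) \<sigma> e)} \<inter> {x \<in> topspace X. \<pi> x \<in> F}" for s \<sigma>
  have tt: "t \<in> torus" using t by (simp add: quarter_turn_def)
  have t2: "t * t \<in> torus" using tt torus_mult by blast
  have Fc: "closed F"
    using face_of_polytope_polytope[OF polytope facet_of_imp_face_of[OF F]] by (rule polytope_imp_closed)
  have FP: "F \<subseteq> P" using F facet_of_imp_subset by blast
  have fixed: "\<rho> t x = x" "\<rho> (t * t) x = x"
    and dich: "(\<forall>e\<in>fibre (\<xi> j) x. gact (\<xi> j) t e = vscale (\<xi> j) 1 e) \<or>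
      (\<forall>e\<in>fibre (\<xi> j) x. gact (\<xi> j) (t * t) e = vscale (\<xi> j) (-1) e)"
    if x: "x \<in> topspace X" "\<pi> x \<in> F" for x
  proof -
    obtain c \<psi> where c: "standard_chart X A \<rho> c \<psi>" "x \<in> fst c"
      using standard x(1) by (auto simp: locally_standard_def)
    obtain k where k: "\<psi> t $ k * \<psi> t $ k = - 1" "\<And>l. l \<noteq> k \<Longrightarrow> \<psi> t $ l = 1" "\<rho> t x = x"
      using quarter_turn_chart[OF t F x(2) c] by metis
    show "\<rho> t x = x" "\<rho> (t * t) x = x" using k(3) act_mult[OF tt tt x(1)] by simp_all
    show "(\<forall>e\<in>fibre (\<xi> j) x. gact (\<xi> j) t e = vscale (\<xi> j) 1 e) \<or>
      (\<forall>e\<in>fibre (\<xi> j) x. gact (\<xi> j) (t * t) e = vscale (\<xi> j) (-1) e)"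
      using plane_bundle_dichotomy[OF Bj x(1) tt k(3)] summand_identity[OF c tt k(3) k(1,2) j] by blast
  qed
  have closedK: "closed (\<pi> ` K s \<sigma>)" if s: "s \<in> torus" for s \<sigma>
  proof (rule invariant_closed_image)
    show "closedin X (K s \<sigma>)"
      unfolding K_def
      using closedin_scalar_action[OF Bj Hausdorff action s] closedin_pi_vimage[OF Fc] by (rule closedin_Int)
    fix x and h :: "complex^'n" assume x: "x \<in> K s \<sigma>" and h: "h \<in> torus"
    then have xX: "x \<in> topspace X" by (simp add: K_def)
    have "\<pi> (\<rho> h x) = \<pi> x" using pi_eq_iff[of x "\<rho> h x"] act_topspace xX h by auto
    moreover have "\<rho> s (\<rho> h x) = \<rho> h (\<rho> s x)"
      using act_mult[OF s h xX] act_mult[OF h s xX] by (simp add: mult.commute)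
    moreover have "\<forall>e\<in>fibre (\<xi> j) (\<rho> h x). gact (\<xi> j) s e = vscale (\<xi> j) \<sigma> e"
      using scalar_action_orbit[OF Bj action xX h s] x unfolding K_def by blast
    ultimately show "\<rho> h x \<in> K s \<sigma>" using x act_topspace[OF h xX] by (simp add: K_def)
  qed
  \<comment> \<open>Connectedness is at hand for the convex set \<open>F\<close>, so the two
    alternatives are compared through their images in \<open>P\<close>. Invariance along orbits lets
    membership of \<open>\<pi> x\<close> be used at \<open>x\<close> itself.\<close>
  let ?R = "\<pi> ` K t 1" and ?S = "\<pi> ` K (t * t) (-1)"
  have memR: "\<pi> x \<in> ?R \<Longrightarrow> x \<in> topspace X \<Longrightarrow> \<forall>e\<in>fibre (\<xi> j) x. gact (\<xi> j) t e = vscale (\<xi> j) 1 e" for x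
  proof -
    assume "\<pi> x \<in> ?R" and x: "x \<in> topspace X"
    then obtain y where y: "y \<in> K t 1" "\<pi> y = \<pi> x" by auto
    then obtain s where "s \<in> torus" "x = \<rho> s y" using pi_eq_iff[of y x] x by (auto simp: K_def)
    then show "\<forall>e\<in>fibre (\<xi> j) x. gact (\<xi> j) t e = vscale (\<xi> j) 1 e"
      using scalar_action_orbit[OF Bj action _ _ tt, of y s 1] y(1) unfolding K_def by blast
  qed
  have memS: "\<pi> x \<in> ?S \<Longrightarrow> x \<in> topspace X \<Longrightarrow>
    \<forall>e\<in>fibre (\<xi> j) x. gact (\<xi> j) (t * t) e = vscale (\<xi> j) (-1) e" for x
  proof -
    assume "\<pi> x \<in> ?S" and x: "x \<in> topspace X"
    then obtain y where y: "y \<in> K (t * t) (-1)" "\<pi> y = \<pi> x" by auto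
    then obtain s where "s \<in> torus" "x = \<rho> s y" using pi_eq_iff[of y x] x by (auto simp: K_def)
    then show "\<forall>e\<in>fibre (\<xi> j) x. gact (\<xi> j) (t * t) e = vscale (\<xi> j) (-1) e"
      using scalar_action_orbit[OF Bj action _ _ t2, of y s "-1"] y(1) unfolding K_def by blast
  qed
  have cover: "F \<subseteq> ?R \<union> ?S"
  proof
    fix p assume p: "p \<in> F"
    then obtain x where x: "x \<in> topspace X" "\<pi> x = p" using FP pi_surj by blast
    then have "x \<in> K t 1 \<or> x \<in> K (t * t) (-1)"
      using fixed[of x] dich[of x] p unfolding K_def by blast
    then show "p \<in> ?R \<union> ?S" using x by blast
  qed
  \<comment> \<open>Over a common point a nonzero vector would equal its negative.\<close>
  have disj: "?R \<inter> ?S \<inter> F = {}"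
  proof (rule ccontr)
    assume "?R \<inter> ?S \<inter> F \<noteq> {}"
    then obtain p where p: "p \<in> ?R" "p \<in> ?S" "p \<in> F" by blast
    have "p \<in> \<pi> ` topspace X" using p(3) FP pi_surj by blast
    then obtain x where x: "x \<in> topspace X" "\<pi> x = p" by blast
    obtain e where e: "e \<in> fibre (\<xi> j) x" "vscale (\<xi> j) 1 e \<noteq> vscale (\<xi> j) (-1) e" "vscale (\<xi> j) 1 e = e"
      using plane_bundle_nonzero[OF Bj x(1)] by metis
    have "gact (\<xi> j) t e = e" using memR[of x] x p(1) e(1,3) by simp
    then have "gact (\<xi> j) (t * t) e = e" using gact_mult[OF Bj tt tt e(1)] by simp
    moreover have "gact (\<xi> j) (t * t) e = vscale (\<xi> j) (-1) e" using memS[of x] x p(2) e(1) by simp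
    ultimately show False using e(2,3) by simp
  qed
  have "connected F"
    using F facet_of_imp_face_of face_of_imp_convex convex_connected by blast
  from connected_closedD[OF this disj cover closedK[OF tt] closedK[OF t2]]
  consider "?R \<inter> F = {}" | "?S \<inter> F = {}" by blast
  then show ?thesis
  proof cases
    case 1
    then have "F \<subseteq> ?S" using cover by blast
    then show ?thesis by (intro disjI2 ballI impI memS[rule_format]) auto
  next
    case 2
    then have "F \<subseteq> ?R" using cover by blast
    then show ?thesis by (intro disjI1 ballI impI memR[rule_format]) auto
  qed
qed

text \<open>Some summand is moved by \<open>t\<close> at a point over \<open>F\<close>. For this
  \<open>j\<close> the first alternative fails there, so the second holds over the whole
  facet.\<close>

lemma facet_color_exists:
  assumes F: "F facet_of P" and t: "quarter_turn F t"
  shows "\<exists>j\<in>{1..r}. \<forall>x\<in>topspace X. \<pi> x \<in> F \<longrightarrow>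
    (\<forall>e\<in>fibre (\<xi> j) x. gact (\<xi> j) (t * t) e = vscale (\<xi> j) (-1) e)"
proof -
  obtain p where "p \<in> F" using F by (auto simp: facet_of_def)
  moreover from this have "p \<in> P" using F facet_of_imp_subset by blast
  ultimately obtain x where x: "x \<in> topspace X" "\<pi> x \<in> F" using pi_surj by blast
  obtain c \<psi> where c: "standard_chart X A \<rho> c \<psi>" "x \<in> fst c"
    using standard x(1) by (auto simp: locally_standard_def)
  obtain k where k: "\<psi> t $ k * \<psi> t $ k = - 1" "\<rho> t x = x"
    using quarter_turn_chart[OF t F x(2) c] by metis
  have tt: "t \<in> torus" using t by (simp add: quarter_turn_def)
  have "\<psi> t $ k \<noteq> 1" using k(1) by auto
  then obtain j e where je: "j \<in> {1..r}" "e \<in> fibre (\<xi> j) x" "gact (\<xi> j) t e \<noteq> e"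
    using some_summand_moved[OF c tt k(2)] by blast
  then have "gact (\<xi> j) t e \<noteq> vscale (\<xi> j) 1 e"
    using vscale_fibre(2)[OF plane[OF je(1)] x(1) je(2)] by simp
  then show ?thesis using facet_dichotomy[OF F t je(1)] x je by blast
qed

text \<open>At a point over two different facets these belong to different coordinates
  \<open>k\<close> and \<open>k'\<close> by \<open>facet_isotropy_inj\<close>, so equal colors would
  contradict \<open>no_common_half_turn\<close>.\<close>

lemma coloring_exists:
  obtains \<kappa> :: "'p set \<Rightarrow> nat" where "\<And>F. F facet_of P \<Longrightarrow> \<kappa> F \<in> {1..r}"
    "\<And>F G. F facet_of P \<Longrightarrow> G facet_of P \<Longrightarrow> F \<noteq> G \<Longrightarrow> F \<inter> G \<noteq> {} \<Longrightarrow> \<kappa> F \<noteq> \<kappa> G"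
proof -
  have "\<forall>F. \<exists>t. F facet_of P \<longrightarrow> quarter_turn F t"
    using quarter_turn_exists by blast
  from choice[OF this] obtain \<tau> where \<tau>: "\<And>F. F facet_of P \<Longrightarrow> quarter_turn F (\<tau> F)" by blast
  have "\<forall>F. \<exists>j. F facet_of P \<longrightarrow> j \<in> {1..r} \<and> (\<forall>x\<in>topspace X. \<pi> x \<in> F \<longrightarrow>
    (\<forall>e\<in>fibre (\<xi> j) x. gact (\<xi> j) (\<tau> F * \<tau> F) e = vscale (\<xi> j) (-1) e))"
    using facet_color_exists[OF _ \<tau>] by blast
  from choice[OF this] obtain \<kappa> where \<kappa>: "\<And>F. F facet_of P \<Longrightarrow> \<kappa> F \<in> {1..r} \<and> (\<forall>x\<in>topspace X. \<pi> x \<in> F \<longrightarrow>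
    (\<forall>e\<in>fibre (\<xi> (\<kappa> F)) x. gact (\<xi> (\<kappa> F)) (\<tau> F * \<tau> F) e = vscale (\<xi> (\<kappa> F)) (-1) e))"
    by blast
  have "\<kappa> F \<noteq> \<kappa> G" if F: "F facet_of P" and G: "G facet_of P" and ne: "F \<noteq> G" "F \<inter> G \<noteq> {}" for F G
  proof
    assume eq: "\<kappa> F = \<kappa> G"
    obtain p where "p \<in> F" "p \<in> G" using ne by blast
    moreover from this have "p \<in> P" using F facet_of_imp_subset by blast
    ultimately obtain x where x: "x \<in> topspace X" "\<pi> x \<in> F" "\<pi> x \<in> G" using pi_surj by blast
    obtain c \<psi> where c: "standard_chart X A \<rho> c \<psi>" "x \<in> fst c"
      using standard x(1) by (auto simp: locally_standard_def)
    obtain k where k: "facet_isotropy F = coordinate_circle \<psi> k"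
      "\<And>l. l \<noteq> k \<Longrightarrow> \<psi> (\<tau> F) $ l = 1" "\<rho> (\<tau> F) x = x"
      using quarter_turn_chart[OF \<tau>[OF F] F x(2) c] by metis
    obtain k' where k': "facet_isotropy G = coordinate_circle \<psi> k'"
      "\<And>l. l \<noteq> k' \<Longrightarrow> \<psi> (\<tau> G) $ l = 1" "\<rho> (\<tau> G) x = x"
      using quarter_turn_chart[OF \<tau>[OF G] G x(3) c] by metis
    have "k \<noteq> k'" using facet_isotropy_inj[OF F G ne(2)] ne(1) k(1) k'(1) by auto
    moreover have "\<tau> F \<in> torus" "\<tau> G \<in> torus" using \<tau> F G by (auto simp: quarter_turn_def)
    moreover have "\<forall>e\<in>fibre (\<xi> (\<kappa> F)) x. gact (\<xi> (\<kappa> F)) (\<tau> F * \<tau> F) e = vscale (\<xi> (\<kappa> F)) (-1) e"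
      using \<kappa>[OF F] x by blast
    moreover have "\<forall>e\<in>fibre (\<xi> (\<kappa> F)) x. gact (\<xi> (\<kappa> F)) (\<tau> G * \<tau> G) e = vscale (\<xi> (\<kappa> F)) (-1) e"
      using \<kappa>[OF G] x unfolding eq by blast
    moreover have "\<kappa> F \<in> {1..r}" using \<kappa>[OF F] by blast
    ultimately show False
      using no_common_half_turn[OF c _ k(3) _ k'(3) k(2) k'(2), where j = "\<kappa> F"] by blast
  qed
  moreover have "\<kappa> F \<in> {1..r}" if "F facet_of P" for F using \<kappa>[OF that] by blast
  ultimately show ?thesis by (rule that[rotated])
qed

end

section \<open>From colors of facets to a coloring of the dual complex\<close>

theorem corollary1p2:
  fixes X :: "'m topology"
    and A :: "('m, complex^'n) chart set"
    and \<rho> :: "complex^'n \<Rightarrow> 'm \<Rightarrow> 'm"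
    and P :: "'p::euclidean_space set"
    and F :: "nat \<Rightarrow> 'p set"
    and m r :: nat
    and \<xi> :: "nat \<Rightarrow> ('m, complex^'n, 'v) equivariant_bundle"
  assumes "quasitoric_manifold X A \<rho> P"
    and "facet_enumeration P m F"
    and "r \<ge> 1"
    and "\<And>j. j \<in> {1..r} \<Longrightarrow> equivariant_vector_bundle X \<rho> 2 (\<xi> j)"
    and "stably_equivariantly_isomorphic X \<rho> (tangent_bundle X A \<rho>) (whitney_sum_family r \<xi>)"
  shows "\<exists>\<kappa>. is_coloring m (dual_complex m F) r \<kappa>"
proof -
  obtain \<pi> where \<pi>: "orbit_projection X A \<rho> P \<pi>"
    using assms(1) by (auto simp: quasitoric_manifold_def)
  obtain a b f where f: "equivariant_bundle_iso
      (whitney_sum (tangent_bundle X A \<rho>) (trivial_bundle X \<rho> a))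
      (whitney_sum (whitney_sum_family r \<xi>) (trivial_bundle X \<rho> b)) f"
    using assms(5) by (auto simp: stably_equivariantly_isomorphic_def)
  have q: "polytope P" "smooth_manifold X A" "smooth_torus_action X A \<rho>" "locally_standard X A \<rho>"
    using assms(1) by (simp_all add: quasitoric_manifold_def simple_polytope_def closed_smooth_manifold_def)
  have q': "Hausdorff_space X" "continuous_torus_action X \<rho>"
    using q(2,3) by (simp_all add: smooth_manifold_def smooth_torus_action_def)
  interpret stable_splitting X A \<rho> P \<pi> r \<xi> a b f
    using q(1,2,4) q' \<pi> f assms(3,4) by unfold_locales
  have F: "bij_betw F {1..m} {G. G facet_of P}"
    using assms(2) by (simp add: facet_enumeration_def)
  then have facet: "F i facet_of P" if "i \<in> {1..m}" for i
    using that by (auto simp: bij_betw_def)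
  show ?thesis
  proof (rule coloring_exists)
    fix \<kappa> assume \<kappa>: "\<And>G. G facet_of P \<Longrightarrow> \<kappa> G \<in> {1..r}"
      "\<And>G H. G facet_of P \<Longrightarrow> H facet_of P \<Longrightarrow> G \<noteq> H \<Longrightarrow> G \<inter> H \<noteq> {} \<Longrightarrow> \<kappa> G \<noteq> \<kappa> H"
    \<comment> \<open>Injectivity on a face compares two vertices at a time, and their facets meet
      because all facets indexed by the face share a point.\<close>
    have "inj_on (\<kappa> \<circ> F) \<alpha>" if \<alpha>: "\<alpha> \<in> dual_complex m F" for \<alpha>
    proof (rule inj_onI, rule ccontr)
      fix i j assume ij: "i \<in> \<alpha>" "j \<in> \<alpha>" "(\<kappa> \<circ> F) i = (\<kappa> \<circ> F) j" "i \<noteq> j"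
      then have \<alpha>': "\<alpha> \<subseteq> {1..m}" "(\<Inter>i\<in>\<alpha>. F i) \<noteq> {}" using \<alpha> by (auto simp: dual_complex_def)
      then have im: "i \<in> {1..m}" "j \<in> {1..m}" using ij by auto
      have "F i \<noteq> F j" using F im ij(4) by (auto simp: bij_betw_def dest: inj_onD)
      moreover have "F i \<inter> F j \<noteq> {}" using \<alpha>'(2) ij by blast
      ultimately show False using \<kappa>(2)[of "F i" "F j"] facet im ij(3) by simp
    qed
    moreover have "\<kappa> \<circ> F \<in> {1..m} \<rightarrow> {1..r}" using \<kappa>(1) facet by auto
    ultimately show ?thesis unfolding is_coloring_def by blast
  qed
qed

end
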